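(* There exists a simple biconnected 4-regular planar graph that does not admit a realization as a system of circles.
   Context: A realization of a simple connected 4-regular planar graph $G$ as a system of circles is a finite set of circles in the plane such that, taking as vertices all points at which two of the circles cross or touch, and as edges all circular arcs of these circles between consecutive such points, the resulting plane graph is $G$. *)

theory Defs
  imports "HOL-Analysis.Analysis" "Graph_Theory.Digraph_Component"
begin

text \<open>
  A finite simple undirected graph is a symmetric, loop-free digraph without parallel arcs
  (locale \<^locale>\<open>graph\<close>), so an undirected edge \<open>{u, v}\<close> is represented by the two arcs
  \<open>u \<rightarrow> v\<close> and \<open>v \<rightarrow> u\<close>, and the degree of a vertex is its out-degree.
\<close>

definition uedges :: "('a, 'b) pre_digraph \<Rightarrow> 'a set set" where
  "uedges G = {{u, v} | u v. (u, v) \<in> arcs_ends G}"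

definition regular :: "nat \<Rightarrow> ('a, 'b) pre_digraph \<Rightarrow> bool" where
  "regular k G \<longleftrightarrow> (\<forall>v \<in> verts G. out_degree G v = k)"

definition biconnected :: "('a, 'b) pre_digraph \<Rightarrow> bool" where
  "biconnected G \<longleftrightarrow> 3 \<le> card (verts G) \<and> Digraph_Component.connected G \<and>
     (\<forall>v \<in> verts G. Digraph_Component.connected (pre_digraph.del_vert G v))"

definition plane_drawing ::
    "('a, 'b) pre_digraph \<Rightarrow> ('a \<Rightarrow> complex) \<Rightarrow> ('a set \<Rightarrow> real \<Rightarrow> complex) \<Rightarrow> bool" where
  "plane_drawing G \<phi> \<gamma> \<longleftrightarrow>
     inj_on \<phi> (verts G) \<and>
     (\<forall>e \<in> uedges G. arc (\<gamma> e) \<and> {pathstart (\<gamma> e), pathfinish (\<gamma> e)} = \<phi> ` e \<and>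
        path_image (\<gamma> e) \<inter> \<phi> ` verts G = \<phi> ` e) \<and>
     (\<forall>e \<in> uedges G. \<forall>e' \<in> uedges G. e \<noteq> e' \<longrightarrow>
        path_image (\<gamma> e) \<inter> path_image (\<gamma> e') \<subseteq> \<phi> ` verts G)"

definition planar :: "('a, 'b) pre_digraph \<Rightarrow> bool" where
  "planar G \<longleftrightarrow> (\<exists>\<phi> \<gamma>. plane_drawing G \<phi> \<gamma>)"

definition circle_system :: "complex set set \<Rightarrow> bool" where
  "circle_system C \<longleftrightarrow> finite C \<and> (\<forall>c \<in> C. \<exists>z r. 0 < r \<and> c = sphere z r)"

definition meeting_points :: "complex set set \<Rightarrow> complex set" where
  "meeting_points C = {p. \<exists>c \<in> C. \<exists>d \<in> C. c \<noteq> d \<and> p \<in> c \<and> p \<in> d}"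

text \<open>
  The closed circular arcs between consecutive meeting points.  The case \<open>t = s + 2 * pi\<close> is
  a circle carrying a single meeting point (a loop).  As the relative interior of an arc contains
  no meeting point, its end points are exactly the meeting points lying on it.
\<close>

definition circle_segments :: "complex set set \<Rightarrow> complex set set" where
  "circle_segments C =
     {(\<lambda>u. z + of_real r * cis u) ` {s..t} | z r s t.
        0 < r \<and> sphere z r \<in> C \<and> s < t \<and> t \<le> s + 2 * pi \<and>
        z + of_real r * cis s \<in> meeting_points C \<and>
        z + of_real r * cis t \<in> meeting_points C \<and>
        (\<forall>u \<in> {s<..<t}. z + of_real r * cis u \<notin> meeting_points C)}"

text \<open>
  The (multi)graph with vertices \<open>meeting_points C\<close> and edges \<open>circle_segments C\<close>
  is isomorphic to \<open>G\<close>.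
\<close>

definition realizes :: "complex set set \<Rightarrow> ('a, 'b) pre_digraph \<Rightarrow> bool" where
  "realizes C G \<longleftrightarrow> circle_system C \<and>
     (\<exists>\<phi> \<psi>. bij_betw \<phi> (verts G) (meeting_points C) \<and>
            bij_betw \<psi> (uedges G) (circle_segments C) \<and>
            (\<forall>e \<in> uedges G. \<psi> e \<inter> meeting_points C = \<phi> ` e))"

end

theory Submission
  imports Defs
begin

text \<open>
  Take an octagon \<open>p\<^sub>1 x\<^sub>1 x\<^sub>2 q\<^sub>1 q\<^sub>2 y\<^sub>2 y\<^sub>1 p\<^sub>2\<close> and join
  \<open>x\<^sub>i\<close> to \<open>y\<^sub>i\<close> (drawn inside) and \<open>p\<^sub>i\<close> to \<open>q\<^sub>i\<close> (drawn outside) by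
  chords, each consisting of two consecutive doubled edges; in every doubled edge one edge is
  replaced by a gadget that is attached by only two edges, which makes the graph simple.  As a
  circle crosses a cut an even number of times, the two edges at a gadget lie on one circle.  Since two
  circles share at most two points, this forces the octagon to lie on a single circle \<open>K\<close>, and each
  chord to consist of two circles that touch \<open>K\<close> at the ends of the chord and meet each other,
  while circles of different chords are disjoint.

  Two circles touching \<open>K\<close> at given points meet if and only if the squared distance of the
  points is at most the product of certain signed sizes of the circles.  Chords with interleaved ends
  must then have sizes of opposite signs, that is, lie on different sides of \<open>K\<close>.  Hence the two
  \<open>x\<close>-chords lie on one side and the two \<open>p\<close>-chords on the other, and each pair bounds the
  cross ratio of its four ends; these two bounds contradict each other.
\<close>

section \<open>Circles tangent to a common circle\<close>

text \<open>Behind the signed sizes is a Moebius map that sends \<open>K\<close> to the real line. A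
  circle touching \<open>K\<close> becomes a circle touching the line, and its size is the signed
  diameter of the image: contact points \<open>a\<close>, \<open>b\<close> and diameters
  \<open>va\<close>, \<open>vb\<close> give circles that meet exactly if
  \<open>(b - a)\<^sup>2 \<le> va * vb\<close>. Only coordinates and diameters are used; the map
  itself is never formed. The cross ratio bounds have the same threshold. For intervals
  \<open>[a, b]\<close> and \<open>[c, d]\<close> compare \<open>(b - a) * (d - c)\<close> with
  \<open>(d - a) * (c - b)\<close>. The \<open>x\<close>-chords force the first product to be at
  least the second for the inner intervals, the \<open>p\<close>-chords force the opposite for the
  outer ones, but enlarging the intervals favours the first product strictly. A chord needs two
  doubled edges in series: two circles running along one doubled edge share just its two ends, which
  is allowed, and the second doubled edge supplies the third common point. The gadget comes from the
  octahedron because this is planar and 4-regular; deleting an edge leaves two vertices of degree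
  three, the places of attachment.\<close>

lemma interleaved_chords_opposite_sign:
  fixes a b c d :: real
  assumes order: "a < c" "c < b" "b < d"
    and meet: "(b - a)\<^sup>2 \<le> va * vb" "(d - c)\<^sup>2 \<le> vc * vd"
    and apart: "va * vc \<le> (c - a)\<^sup>2" "vb * vd \<le> (d - b)\<^sup>2"
  shows "va * vc < 0"
proof (rule ccontr)
  assume "\<not> va * vc < 0"
  have pos: "0 < va * vb" "0 < vc * vd"
    using order meet by (smt (verit) zero_less_power)+
  then have "0 \<le> va * vc" "0 \<le> vb * vd"
    using \<open>\<not> va * vc < 0\<close> by (auto simp: zero_le_mult_iff zero_less_mult_iff mult_less_0_iff)
  have "((b - a) * (d - c))\<^sup>2 \<le> (va * vb) * (vc * vd)"
    unfolding power_mult_distrib using meet pos by (intro mult_mono) auto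
  also have "\<dots> = (va * vc) * (vb * vd)"
    by simp
  also have "\<dots> \<le> ((c - a) * (d - b))\<^sup>2"
    unfolding power_mult_distrib using apart \<open>0 \<le> vb * vd\<close> by (intro mult_mono) auto
  finally have "(b - a) * (d - c) \<le> (c - a) * (d - b)"
    by (rule power2_le_imp_le) (use order in simp)
  \<comment> \<open>Ptolemy's identity for four points on a line: the product of the interleaved
    lengths exceeds either of the two other products.\<close>
  moreover have "(b - a) * (d - c) = (c - a) * (d - b) + (b - c) * (d - a)"
    by (simp add: algebra_simps)
  moreover have "0 < (b - c) * (d - a)"
    using order by simp
  ultimately show False
    by simp
qed

text \<open>The product of all four sizes is bounded below when grouped by chords and above when
  grouped by pairs of circles that are apart. Comparing the two groupings eliminates the
  sizes.\<close>

lemma parallel_chords_le: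
  fixes a a' c c' :: real
  assumes meet: "(a' - a)\<^sup>2 \<le> va * va'" "(c' - c)\<^sup>2 \<le> vc * vc'"
    and apart: "va * vc \<le> x\<^sup>2" "va' * vc' \<le> y\<^sup>2"
    and sign: "0 < va * vc" "0 \<le> x" "0 \<le> y"
  shows "(a' - a) * (c' - c) \<le> x * y"
proof -
  have "0 \<le> va * va'" "0 \<le> vc * vc'"
    using meet by (smt (verit) zero_le_power2)+
  then have "0 \<le> va' * vc'"
    using sign by (auto simp: zero_le_mult_iff zero_less_mult_iff)
  have "((a' - a) * (c' - c))\<^sup>2 \<le> (va * va') * (vc * vc')"
    unfolding power_mult_distrib using meet \<open>0 \<le> va * va'\<close> by (intro mult_mono) auto
  also have "\<dots> = (va * vc) * (va' * vc')"
    by simp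
  also have "\<dots> \<le> (x * y)\<^sup>2"
    unfolding power_mult_distrib using apart \<open>0 \<le> va' * vc'\<close> by (intro mult_mono) auto
  finally show ?thesis
    by (rule power2_le_imp_le) (use sign in simp)
qed

text \<open>With interval lengths \<open>P\<close>, \<open>R\<close> and gap \<open>q\<close> the
  conclusion reads \<open>(P + q + R) * q < P * R\<close>, that is,
  \<open>2 * q\<^sup>2 < (P - q) * (R - q)\<close>. Longer intervals and a smaller gap only
  help.\<close>

lemma cross_ratio_mono:
  fixes a b c d a' b' c' d' :: real
  assumes "a < a'" "a' < b'" "b' < b" "b < c" "c < c'" "c' < d'" "d' < d"
    and "(d' - a') * (c' - b') \<le> (b' - a') * (d' - c')"
  shows "(d - a) * (c - b) < (b - a) * (d - c)"
proof -
  define P R Q p r q where "P = b - a" "R = d - c" "Q = c' - b'" "p = b' - a'" "r = d' - c'" "q = c - b"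
  note defs = this
  have pos: "0 < q" "q < Q" "0 < p" "p < P" "0 < r" "r < R"
    using assms by (auto simp: defs)
  have le: "2 * Q\<^sup>2 \<le> (p - Q) * (r - Q)"
    using assms(8) by (simp add: defs algebra_simps power2_eq_square)
  \<comment> \<open>The inequality \<open>le\<close> alone would admit two negative factors; this
    form shows that both are positive, as monotonicity of the product requires.\<close>
  have "p * Q + Q * Q + r * Q \<le> p * r"
    using le by (simp add: algebra_simps power2_eq_square)
  then have "p * Q < p * r" "Q * r < p * r"
    using pos by (smt (verit) mult_pos_pos mult.commute)+
  then have "Q < r" "Q < p"
    using pos by auto
  then have "(p - Q) * (r - Q) < (P - q) * (R - q)"
    using pos by (intro mult_strict_mono) auto
  moreover have "2 * q\<^sup>2 < 2 * Q\<^sup>2"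
    using pos by (simp add: power_strict_mono)
  ultimately have "2 * q\<^sup>2 < (P - q) * (R - q)"
    using le by linarith
  then show ?thesis
    by (simp add: defs algebra_simps power2_eq_square)
qed

lemma no_eight_chords:
  fixes t v :: "nat \<Rightarrow> real"
  assumes order: "t 0 < t 1" "t 1 < t 2" "t 2 < t 3" "t 3 < t 4" "t 4 < t 5" "t 5 < t 6" "t 6 < t 7"
    and meet: "(t 3 - t 0)\<^sup>2 \<le> v 0 * v 3" "(t 6 - t 1)\<^sup>2 \<le> v 1 * v 6"
      "(t 5 - t 2)\<^sup>2 \<le> v 2 * v 5" "(t 7 - t 4)\<^sup>2 \<le> v 4 * v 7"
    and apart: "\<And>i j. i < j \<Longrightarrow> j < 8 \<Longrightarrow> (i, j) \<notin> {(0, 3), (1, 6), (2, 5), (4, 7)}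
      \<Longrightarrow> v i * v j \<le> (t j - t i)\<^sup>2"
  shows False
proof -
  have "v 0 * v 1 < 0"
    using interleaved_chords_opposite_sign[of "t 0" "t 1" "t 3" "t 6" "v 0" "v 3" "v 1" "v 6"]
      order meet apart[of 0 1] apart[of 3 6] by simp
  moreover have "v 0 * v 2 < 0"
    using interleaved_chords_opposite_sign[of "t 0" "t 2" "t 3" "t 5" "v 0" "v 3" "v 2" "v 5"]
      order meet apart[of 0 2] apart[of 3 5] by simp
  moreover have "v 1 * v 4 < 0"
    using interleaved_chords_opposite_sign[of "t 1" "t 4" "t 6" "t 7" "v 1" "v 6" "v 4" "v 7"]
      order meet apart[of 1 4] apart[of 6 7] by simp
  ultimately have sign: "0 < v 1 * v 2" "0 < v 0 * v 4"
    by (auto simp: mult_less_0_iff zero_less_mult_iff)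
  have "v 0 * v 3 > 0" "v 4 * v 7 > 0"
    using meet order by (smt (verit) zero_less_power)+
  then have sign': "0 < v 0 * v 7"
    using sign by (auto simp: zero_less_mult_iff)
  have x: "(t 6 - t 1) * (t 5 - t 2) \<le> (t 2 - t 1) * (t 6 - t 5)"
    by (rule parallel_chords_le[where va = "v 1" and va' = "v 6" and vc = "v 2" and vc' = "v 5"])
      (use meet order apart[of 1 2] apart[of 5 6] sign in \<open>auto simp: mult.commute\<close>)
  \<comment> \<open>Here the second chord is read from 7 to 4, so that the pairs that are apart
    become 0, 7 and 3, 4.\<close>
  have "(t 3 - t 0) * (t 7 - t 4) \<le> (t 7 - t 0) * (t 4 - t 3)"
    by (rule parallel_chords_le[where va = "v 0" and va' = "v 3" and vc = "v 7" and vc' = "v 4"])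
      (use meet order apart[of 0 7] apart[of 3 4] sign' in \<open>auto simp: mult.commute power2_commute\<close>)
  moreover have "(t 7 - t 0) * (t 4 - t 3) < (t 3 - t 0) * (t 7 - t 4)"
    by (rule cross_ratio_mono[OF _ _ _ _ _ _ _ x]) (use order in auto)
  ultimately show False
    by simp
qed

text \<open>By Heron's formula this is minus sixteen times the squared area of a triangle with sides
  \<open>dist z w\<close>, \<open>r\<close> and \<open>s\<close>. One polynomial sign thus covers
  both the inner and the outer distance condition.\<close>

definition circles_discr :: "complex \<Rightarrow> real \<Rightarrow> complex \<Rightarrow> real \<Rightarrow> real" where
  "circles_discr z r w s =
     ((dist z w)\<^sup>2 - (r - s)\<^sup>2) * ((dist z w)\<^sup>2 - (r + s)\<^sup>2)"

lemma circles_discr_nonpos_if_meet: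
  assumes "p \<in> sphere z r" "p \<in> sphere w s"
  shows "circles_discr z r w s \<le> 0"
proof -
  have "\<bar>r - s\<bar> \<le> dist z w" "dist z w \<le> r + s" "0 \<le> r" "0 \<le> s"
    using assms dist_triangle[of z w p] dist_triangle[of z p w] dist_triangle[of w p z]
    by (auto simp: dist_commute)
  then have "(r - s)\<^sup>2 \<le> (dist z w)\<^sup>2" "(dist z w)\<^sup>2 \<le> (r + s)\<^sup>2"
    by (auto intro: power_mono simp: abs_le_square_iff[symmetric])
  then show ?thesis
    unfolding circles_discr_def by (simp add: mult_nonneg_nonpos)
qed

lemma circles_meet_if_discr_neg:
  assumes "0 < r" "0 < s" "circles_discr z r w s < 0"
  shows "sphere z r \<inter> sphere w s \<noteq> {}"
proof -
  define d where "d = dist z w"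
  have "(r - s)\<^sup>2 < (r + s)\<^sup>2"
    using assms by (simp add: power2_eq_square algebra_simps)
  then have d2: "(r - s)\<^sup>2 < d\<^sup>2" "d\<^sup>2 < (r + s)\<^sup>2"
    using assms(3) by (auto simp: circles_discr_def d_def mult_less_0_iff)
  have "0 < d\<^sup>2"
    using d2(1) zero_le_power2[of "r - s"] by linarith
  then have "0 < d"
    by (simp add: d_def)
  have d: "\<bar>r - s\<bar> < d" "d < r + s"
    by (rule power2_less_imp_less; use d2 \<open>0 < d\<close> assms in simp)+
  \<comment> \<open>Position of the radical axis on the line of centres, measured from
    \<open>z\<close>; \<open>y\<close> below is the height of a common point over that line.\<close>
  define x where "x = (d\<^sup>2 + r\<^sup>2 - s\<^sup>2) / (2 * d)"
  \<comment> \<open>The product equals \<open>4 * d\<^sup>2 * (r\<^sup>2 - x\<^sup>2)\<close>, and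
    its nonnegativity makes \<open>y\<close> a genuine square root.\<close>
  have "0 \<le> (2 * d * r - (d\<^sup>2 + r\<^sup>2 - s\<^sup>2)) * (2 * d * r + (d\<^sup>2 + r\<^sup>2 - s\<^sup>2))"
  proof -
    have "2 * d * r - (d\<^sup>2 + r\<^sup>2 - s\<^sup>2) = s\<^sup>2 - (d - r)\<^sup>2"
      by (simp add: power2_eq_square algebra_simps)
    moreover have "2 * d * r + (d\<^sup>2 + r\<^sup>2 - s\<^sup>2) = (d + r)\<^sup>2 - s\<^sup>2"
      by (simp add: power2_eq_square algebra_simps)
    moreover have "(d - r)\<^sup>2 \<le> s\<^sup>2"
      using d assms by (intro abs_le_square_iff[THEN iffD1]) auto
    moreover have "s\<^sup>2 \<le> (d + r)\<^sup>2"
      using d assms by (intro power_mono) auto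
    ultimately show ?thesis
      by simp
  qed
  then have "(d\<^sup>2 + r\<^sup>2 - s\<^sup>2)\<^sup>2 \<le> (2 * d * r)\<^sup>2"
    by (simp add: power2_eq_square algebra_simps)
  then have "x\<^sup>2 \<le> r\<^sup>2"
    using \<open>0 < d\<close> by (simp add: x_def power_divide divide_le_eq power_mult_distrib mult.commute)
  define y where "y = sqrt (r\<^sup>2 - x\<^sup>2)"
  have y: "x\<^sup>2 + y\<^sup>2 = r\<^sup>2"
    using \<open>x\<^sup>2 \<le> r\<^sup>2\<close> by (simp add: y_def)
  have xd: "2 * d * x = d\<^sup>2 + r\<^sup>2 - s\<^sup>2"
    using \<open>0 < d\<close> by (simp add: x_def)
  define e where "e = (w - z) / d"
  have e: "cmod e = 1" "w = z + d * e"
    using \<open>0 < d\<close> by (auto simp: e_def norm_divide d_def dist_norm norm_minus_commute)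
  define p where "p = z + Complex x y * e"
  have "dist z p = sqrt (x\<^sup>2 + y\<^sup>2)"
    by (simp add: p_def dist_norm norm_mult e complex_norm)
  then have "p \<in> sphere z r"
    using y assms by simp
  moreover have "w - p = Complex (d - x) (- y) * e"
    by (simp add: p_def e(2) complex_eq_iff algebra_simps)
  then have "dist w p = sqrt ((d - x)\<^sup>2 + y\<^sup>2)"
    by (simp add: dist_norm norm_mult e complex_norm)
  moreover have "(d - x)\<^sup>2 + y\<^sup>2 = s\<^sup>2"
    using y xd by (simp add: power2_eq_square algebra_simps)
  ultimately show ?thesis
    using assms by auto
qed

text \<open>The law of cosines with \<open>1 - cos\<close> replaced by twice the squared sine of the
  half angle. The distances \<open>k\<close> and \<open>l\<close> are signed, which admits centres
  beyond \<open>z\<close>.\<close>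

lemma dist_sq_of_directions:
  "(dist (z + of_real k * cis a) (z + of_real l * cis b))\<^sup>2 =
     (k - l)\<^sup>2 + 4 * k * l * (sin ((a - b) / 2))\<^sup>2"
proof -
  have "cos (a - b) = 1 - 2 * (sin ((a - b) / 2))\<^sup>2"
    by (metis cos_double_sin field_sum_of_halves mult_2)
  then have c: "cos a * cos b + sin a * sin b = 1 - 2 * (sin ((a - b) / 2))\<^sup>2"
    by (simp add: cos_diff)
  have "(dist (z + of_real k * cis a) (z + of_real l * cis b))\<^sup>2 =
      (k * cos a - l * cos b)\<^sup>2 + (k * sin a - l * sin b)\<^sup>2"
    by (simp add: dist_norm cmod_power2)
  also have "\<dots> = k\<^sup>2 * ((sin a)\<^sup>2 + (cos a)\<^sup>2) + l\<^sup>2 * ((sin b)\<^sup>2 + (cos b)\<^sup>2)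
      - 2 * k * l * (cos a * cos b + sin a * sin b)"
    by (simp only: power2_eq_square) argo
  also have "\<dots> = (k - l)\<^sup>2 + 4 * k * l * (sin ((a - b) / 2))\<^sup>2"
    unfolding c by (simp add: power2_diff right_diff_distrib)
  finally show ?thesis .
qed

text \<open>Reflection in the line of centres preserves both circles, hence fixes their only common
  point, which therefore lies on that line. The sign of the radius unifies three positions:
  \<open>s < 0\<close> for contact from outside, \<open>0 < s < R\<close> for a circle inside
  \<open>sphere z R\<close>, \<open>R < s\<close> for a circle around it.\<close>

lemma tangent_circle_center:
  assumes "0 < R" and tangent: "sphere z R \<inter> sphere w r = {z + of_real R * cis a}"
    and "sphere w r \<noteq> sphere z R"
  obtains s where "w = z + of_real (R - s) * cis a" "r = \<bar>s\<bar>" "s \<noteq> R"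
proof -
  define p where "p = of_real R * cis a"
  define c where "c = w - z"
  have "z + p \<in> sphere w r"
    using tangent by (auto simp: p_def)
  then have r: "cmod (c - p) = r"
    by (simp add: dist_norm c_def algebra_simps)
  have p: "cmod p = R"
    using \<open>0 < R\<close> by (simp add: p_def norm_mult)
  have "c \<noteq> 0"
  proof
    assume "c = 0"
    then have "w = z" "r = R"
      using r p by (auto simp: c_def)
    then show False
      using assms(3) by simp
  qed
  \<comment> \<open>The mirror image of \<open>p\<close> in the line through \<open>0\<close> and
    \<open>c\<close>.\<close>
  define q where "q = c / cnj c * cnj p"
  have "cmod q = R"
    using p \<open>c \<noteq> 0\<close> by (simp add: q_def norm_mult norm_divide)
  moreover have "c - q = c / cnj c * cnj (c - p)"
    using \<open>c \<noteq> 0\<close> by (simp add: q_def field_simps)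
  then have "cmod (c - q) = r"
    using r \<open>c \<noteq> 0\<close> by (simp only: norm_mult norm_divide complex_mod_cnj) simp
  ultimately have "z + q \<in> sphere z R \<inter> sphere w r"
    by (simp add: dist_norm c_def algebra_simps)
  then have "q = p"
    using tangent by (simp add: p_def)
  then have "c * cnj p = cnj (c * cnj p)"
    using \<open>c \<noteq> 0\<close> by (simp add: q_def field_simps)
  then obtain k :: real where k: "c * cnj p = of_real k"
    by (metis Reals_cnj_iff Reals_cases)
  have "c * (cnj p * p) = of_real k * p"
    unfolding k[symmetric] by (simp only: mult.assoc)
  moreover have "cnj p * p = (of_real R)\<^sup>2"
    using complex_norm_square[of p] p by (simp add: mult.commute)
  ultimately have "c * (of_real R)\<^sup>2 = of_real k * p"
    by (simp only:)
  moreover have "of_real R * (of_real R * c) = c * (of_real R)\<^sup>2"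
    by (simp add: power2_eq_square)
  moreover have "of_real k * p = of_real R * (of_real k * cis a)"
    by (simp add: p_def)
  ultimately have "of_real R * (of_real R * c) = of_real R * (of_real k * cis a)"
    by metis
  then have "of_real R * c = of_real k * cis a"
    using \<open>0 < R\<close> by (simp only: mult_cancel_left of_real_eq_0_iff) auto
  then have "c = of_real k * cis a / of_real R"
    using \<open>0 < R\<close> by (metis nonzero_mult_div_cancel_left of_real_eq_0_iff less_irrefl)
  then have c: "c = of_real (k / R) * cis a"
    by (simp only: of_real_divide times_divide_eq_left)
  then have "c - p = of_real (k / R - R) * cis a"
    by (simp add: p_def algebra_simps)
  then have "r = \<bar>k / R - R\<bar>"
    using r by (simp only: norm_mult norm_of_real norm_cis mult_1_right)
  moreover have "k \<noteq> 0"
    using c \<open>c \<noteq> 0\<close> by auto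
  ultimately show thesis
    using c \<open>0 < R\<close> by (intro that[of "R - k / R"]) (auto simp: c_def diff_eq_eq add.commute)
qed

text \<open>
  For a circle touching \<open>sphere z R\<close> at \<open>z + R * cis a\<close> the signed ratio
  \<open>s / (R - s)\<close> plays the role of a curvature: it makes the condition that two such circles
  meet symmetric and independent of the side on which they lie.
\<close>

lemma tangent_circles_discr:
  fixes s t R :: real
  assumes "s \<noteq> R" "t \<noteq> R"
  shows "circles_discr (z + of_real (R - s) * cis a) \<bar>s\<bar> (z + of_real (R - t) * cis b) \<bar>t\<bar> =
    16 * ((R - s) * (R - t) * sin ((a - b) / 2))\<^sup>2 *
      ((sin ((a - b) / 2))\<^sup>2 - s / (R - s) * (t / (R - t)))"
proof -
  define k l S where "k = R - s" "l = R - t" "S = (sin ((a - b) / 2))\<^sup>2"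
  note defs = this
  have "k \<noteq> 0" "l \<noteq> 0"
    using assms by (auto simp: defs)
  have d: "(dist (z + of_real k * cis a) (z + of_real l * cis b))\<^sup>2 = (s - t)\<^sup>2 + 4 * k * l * S"
    unfolding dist_sq_of_directions by (simp add: defs power2_commute)
  \<comment> \<open>If \<open>s\<close> and \<open>t\<close> have opposite signs the two factors
    merely change places, so the absolute values disappear without a case distinction in the
    result.\<close>
  have "(x - (\<bar>s\<bar> - \<bar>t\<bar>)\<^sup>2) * (x - (\<bar>s\<bar> + \<bar>t\<bar>)\<^sup>2) = (x - (s - t)\<^sup>2) * (x - (s - t)\<^sup>2 - 4 * s * t)" for x
    by (auto simp: abs_if power2_eq_square algebra_simps)
  then have "circles_discr (z + of_real k * cis a) \<bar>s\<bar> (z + of_real l * cis b) \<bar>t\<bar> =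
      (4 * k * l * S) * (4 * k * l * S - 4 * s * t)"
    unfolding circles_discr_def d by simp
  also have "\<dots> = 16 * ((k * l)\<^sup>2 * S) * (S - s / k * (t / l))"
  proof -
    have "s * t = (k * l) * (s / k * (t / l))"
      using \<open>k \<noteq> 0\<close> \<open>l \<noteq> 0\<close> by simp
    then have "4 * k * l * S - 4 * s * t = 4 * (k * l) * (S - s / k * (t / l))"
      by (metis (no_types, lifting) mult.assoc right_diff_distrib)
    then show ?thesis
      by (simp add: power2_eq_square)
  qed
  finally show ?thesis
    by (simp add: defs power_mult_distrib)
qed

lemma sin_sq_le_if_tangent_circles_meet:
  fixes s t R :: real
  assumes "s \<noteq> R" "t \<noteq> R" "sin ((a - b) / 2) \<noteq> 0"
    and "p \<in> sphere (z + of_real (R - s) * cis a) \<bar>s\<bar>"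
    and "p \<in> sphere (z + of_real (R - t) * cis b) \<bar>t\<bar>"
  shows "(sin ((a - b) / 2))\<^sup>2 \<le> s / (R - s) * (t / (R - t))"
proof -
  have "0 < 16 * ((R - s) * (R - t) * sin ((a - b) / 2))\<^sup>2"
    using assms by simp
  then show ?thesis
    using circles_discr_nonpos_if_meet[OF assms(4,5)] unfolding tangent_circles_discr[OF assms(1,2)]
    by (simp only: mult_le_0_iff) linarith
qed

lemma sin_sq_ge_if_tangent_circles_apart:
  fixes s t R :: real
  assumes "s \<noteq> R" "t \<noteq> R" "s \<noteq> 0" "t \<noteq> 0" "sin ((a - b) / 2) \<noteq> 0"
    and apart: "sphere (z + of_real (R - s) * cis a) \<bar>s\<bar> \<inter>
      sphere (z + of_real (R - t) * cis b) \<bar>t\<bar> = {}"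
  shows "s / (R - s) * (t / (R - t)) \<le> (sin ((a - b) / 2))\<^sup>2"
proof -
  have "0 < 16 * ((R - s) * (R - t) * sin ((a - b) / 2))\<^sup>2"
    using assms by simp
  moreover have "\<not> circles_discr (z + of_real (R - s) * cis a) \<bar>s\<bar> (z + of_real (R - t) * cis b) \<bar>t\<bar> < 0"
    using circles_meet_if_discr_neg apart assms(3,4) by (metis zero_less_abs_iff)
  ultimately show ?thesis
    unfolding tangent_circles_discr[OF assms(1,2)] by (metis diff_less_0_iff_less mult_pos_neg not_le)
qed

lemma no_eight_tangent_circles:
  fixes a r :: "nat \<Rightarrow> real" and w :: "nat \<Rightarrow> complex"
  assumes "0 < R" and order: "\<And>i j. i < j \<Longrightarrow> j < 8 \<Longrightarrow> a i < a j" and turn: "a 7 < a 0 + 2 * pi"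
    and r: "\<And>i. i < 8 \<Longrightarrow> 0 < r i"
    and tangent: "\<And>i. i < 8 \<Longrightarrow> sphere z R \<inter> sphere (w i) (r i) = {z + of_real R * cis (a i)}"
      "\<And>i. i < 8 \<Longrightarrow> sphere (w i) (r i) \<noteq> sphere z R"
    and meet: "\<And>i j. (i, j) \<in> {(0, 3), (1, 6), (2, 5), (4, 7)}
      \<Longrightarrow> sphere (w i) (r i) \<inter> sphere (w j) (r j) \<noteq> {}"
    and apart: "\<And>i j. i < j \<Longrightarrow> j < 8 \<Longrightarrow> (i, j) \<notin> {(0, 3), (1, 6), (2, 5), (4, 7)}
      \<Longrightarrow> sphere (w i) (r i) \<inter> sphere (w j) (r j) = {}"
  shows False
proof -
  have "\<exists>s. w i = z + of_real (R - s) * cis (a i) \<and> r i = \<bar>s\<bar> \<and> s \<noteq> R" if "i < 8" for i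
    using tangent_circle_center[OF \<open>0 < R\<close> tangent[OF that]] by metis
  then obtain s where s: "w i = z + of_real (R - s i) * cis (a i)" "r i = \<bar>s i\<bar>" "s i \<noteq> R"
    if "i < 8" for i
    by metis
  have s0: "s i \<noteq> 0" if "i < 8" for i
    using r[OF that] s(2)[OF that] by auto
  \<comment> \<open>The centre of projection lies opposite the middle of the range from
    \<open>a 0\<close> to \<open>a 7\<close>, hence in the gap between the last and the first point.
    So the eight points keep their order on the line.\<close>
  define h where "h = (a 0 + a 7) / 2 - pi"
  define b where "b i = (a i - h) / 2" for i
  \<comment> \<open>Stereographic coordinate of the contact point. In \<open>v\<close> below, the
    factor \<open>1 / (sin (b i))\<^sup>2\<close> is the derivative of \<open>- cot\<close> there,
    by which the projection rescales the size of the circle.\<close>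
  define t where "t i = - cot (b i)" for i
  define v where "v i = s i / (R - s i) / (sin (b i))\<^sup>2" for i
  have b: "0 < b i" "b i < pi" if "i < 8" for i
  proof -
    have "a 0 \<le> a i" "a i \<le> a 7"
      using order[of 0 i] order[of i 7] that by (cases "i = 0"; cases "i = 7"; force)+
    then show "0 < b i" "b i < pi"
      using turn unfolding b_def h_def by (auto simp: field_simps)
  qed
  have sinb: "0 < sin (b i)" if "i < 8" for i
    using b[OF that] by (rule sin_gt_zero)
  have diff: "sin ((a j - a i) / 2) = sin (b i) * sin (b j) * (t j - t i)" if "i < 8" "j < 8" for i j
  proof -
    have "(a j - a i) / 2 = b j - b i"
      by (simp add: b_def field_simps)
    then have "sin ((a j - a i) / 2) = sin (b j) * cos (b i) - cos (b j) * sin (b i)"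
      by (simp only: sin_diff)
    then show ?thesis
      using sinb[OF that(1)] sinb[OF that(2)] by (simp add: t_def cot_def algebra_simps)
  qed
  have t: "t i < t j" if "i < j" "j < 8" for i j
  proof -
    have "0 < sin ((a j - a i) / 2)"
      using order[OF that] b[of j] b[of i] that by (intro sin_gt_zero) (auto simp: b_def field_simps)
    then show ?thesis
      unfolding diff[OF order.strict_trans[OF that] that(2)] using sinb[of i] sinb[of j] that
      by (auto simp: zero_less_mult_iff mult_less_0_iff)
  qed
  have n: "sin ((a j - a i) / 2) \<noteq> 0" if "i < j" "j < 8" for i j
    using t[OF that] sinb[of i] sinb[of j] that by (simp add: diff)
  have sq: "(t j - t i)\<^sup>2 = (sin ((a j - a i) / 2))\<^sup>2 / ((sin (b i))\<^sup>2 * (sin (b j))\<^sup>2)" if "i < j" "j < 8" for i j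
    using sinb[of i] sinb[of j] that by (simp add: diff power_mult_distrib)
  have vv: "v i * v j = s i / (R - s i) * (s j / (R - s j)) / ((sin (b i))\<^sup>2 * (sin (b j))\<^sup>2)" for i j
    by (simp add: v_def)
  have le: "(t j - t i)\<^sup>2 \<le> v i * v j" if chord: "(i, j) \<in> {(0, 3), (1, 6), (2, 5), (4, 7)}" for i j
  proof -
    have ij: "i < j" "j < 8" "i < 8"
      using that by auto
    obtain p where "p \<in> sphere (w j) (r j)" "p \<in> sphere (w i) (r i)"
      using meet[OF chord] by blast
    then have "(sin ((a j - a i) / 2))\<^sup>2 \<le> s j / (R - s j) * (s i / (R - s i))"
      using s ij by (intro sin_sq_le_if_tangent_circles_meet[where p = p and z = z] n) auto
    then show ?thesis
      unfolding sq[OF ij(1,2)] vv by (intro divide_right_mono) (auto simp: mult.commute)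
  qed
  have ge: "v i * v j \<le> (t j - t i)\<^sup>2"
    if ij: "i < j" "j < 8" and "(i, j) \<notin> {(0, 3), (1, 6), (2, 5), (4, 7)}" for i j
  proof -
    have "i < 8"
      using ij by simp
    have "s j / (R - s j) * (s i / (R - s i)) \<le> (sin ((a j - a i) / 2))\<^sup>2"
      by (rule sin_sq_ge_if_tangent_circles_apart[where z = z])
        (use s[OF ij(2)] s[OF \<open>i < 8\<close>] s0 n ij apart[OF that] in \<open>auto simp: Int_commute\<close>)
    then show ?thesis
      unfolding sq[OF ij(1,2)] vv by (intro divide_right_mono) (auto simp: mult.commute)
  qed
  show False
    by (rule no_eight_chords[of t v]) (use t le ge in auto)
qed

section \<open>Circle systems as decompositions into cycles\<close>

text \<open>Multiplying by \<open>cnj c\<close> gives coordinates along and across the line of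
  centres. The radical axis fixes the first and the radius fixes the square of the second, so
  different centres leave at most two points.\<close>

lemma three_common_points:
  fixes z w :: complex
  assumes "p \<in> sphere z r" "q \<in> sphere z r" "q' \<in> sphere z r"
    and "p \<in> sphere w s" "q \<in> sphere w s" "q' \<in> sphere w s"
    and "p \<noteq> q" "p \<noteq> q'" "q \<noteq> q'"
  shows "z = w"
proof (rule ccontr)
  assume "z \<noteq> w"
  define c where "c = w - z"
  have "c \<noteq> 0"
    using \<open>z \<noteq> w\<close> by (simp add: c_def)
  define k where "k = (r\<^sup>2 + (cmod c)\<^sup>2 - s\<^sup>2) / 2"
  have *: "Re ((x - z) * cnj c) = k \<and> (Im ((x - z) * cnj c))\<^sup>2 = r\<^sup>2 * (cmod c)\<^sup>2 - k\<^sup>2"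
    if "x \<in> sphere z r" "x \<in> sphere w s" for x
  proof -
    have r: "(cmod (x - z))\<^sup>2 = r\<^sup>2"
      using that by (simp add: dist_norm norm_minus_commute)
    have s: "(cmod ((x - z) - c))\<^sup>2 = s\<^sup>2"
      using that by (simp add: dist_norm norm_minus_commute c_def)
    have 1: "Re ((x - z) * cnj c) = k"
      using r s unfolding k_def cmod_power2 by (simp add: power2_eq_square algebra_simps)
    have "(cmod ((x - z) * cnj c))\<^sup>2 = r\<^sup>2 * (cmod c)\<^sup>2"
      by (simp add: norm_mult power_mult_distrib r)
    then have "(Re ((x - z) * cnj c))\<^sup>2 + (Im ((x - z) * cnj c))\<^sup>2 = r\<^sup>2 * (cmod c)\<^sup>2"
      by (simp only: cmod_power2)
    then show ?thesis
      using 1 by simp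
  qed
  have inj: "x = y" if "(x - z) * cnj c = (y - z) * cnj c" for x y
    using that \<open>c \<noteq> 0\<close> by (simp only: mult_cancel_right complex_cnj_zero_iff) simp
  have eq: "x = y" if "x \<in> sphere z r" "x \<in> sphere w s" "y \<in> sphere z r" "y \<in> sphere w s"
    "Im ((x - z) * cnj c) = Im ((y - z) * cnj c)" for x y
  proof (rule inj, rule complex_eqI)
    show "Re ((x - z) * cnj c) = Re ((y - z) * cnj c)"
      using *[OF that(1,2)] *[OF that(3,4)] by (simp only:)
  qed (rule that(5))
  have "(Im ((p - z) * cnj c))\<^sup>2 = (Im ((q - z) * cnj c))\<^sup>2"
    "(Im ((p - z) * cnj c))\<^sup>2 = (Im ((q' - z) * cnj c))\<^sup>2"
    using *[OF assms(1,4)] *[OF assms(2,5)] *[OF assms(3,6)] by (simp_all only:)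
  then show False
    using eq[OF assms(1,4,2,5)] eq[OF assms(1,4,3,6)] eq[OF assms(2,5,3,6)] assms(7-9)
    unfolding power2_eq_iff by argo
qed

lemma sphere_eqD:
  fixes z w :: complex
  assumes "sphere z r = sphere w s" "0 < r"
  shows "z = w" "r = s"
proof -
  have in_z: "z + of_real r * x \<in> sphere z r" if "cmod x = 1" for x
    using that \<open>0 < r\<close> by (simp add: dist_norm norm_mult)
  have "z + of_real r * 1 \<noteq> z + of_real r * (- 1)" "z + of_real r * 1 \<noteq> z + of_real r * \<i>"
    "z + of_real r * (- 1) \<noteq> z + of_real r * \<i>"
    using \<open>0 < r\<close> by (simp_all add: complex_eq_iff)
  note distinct = this
  have m: "cmod 1 = 1" "cmod (- 1) = 1" "cmod \<i> = 1"
    by simp_all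
  have in_w: "z + of_real r * x \<in> sphere w s" if "cmod x = 1" for x
    using in_z[OF that] assms(1) by simp
  show "z = w"
    by (rule three_common_points[OF in_z[OF m(1)] in_z[OF m(2)] in_z[OF m(3)]
          in_w[OF m(1)] in_w[OF m(2)] in_w[OF m(3)] distinct])
  then show "r = s"
    using in_w[OF m(1)] \<open>0 < r\<close> by (simp add: dist_norm)
qed

lemma inj_on_circle_param:
  assumes "0 < r" "\<bar>u - u'\<bar> < 2 * pi" "z + of_real r * cis u = z + of_real r * cis u'"
  shows "u = u'"
proof -
  have "cis u = cis u'"
    using assms by simp
  then have "cis (u - u') = 1"
    by (simp add: cis_divide[symmetric])
  then have "cos (u - u') = 1"
    by (metis cis.sel(1) one_complex.sel(1))
  then obtain n :: int where "u - u' = of_int n * (2 * pi)"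
    using cos_one_2pi_int by auto
  moreover from this have "\<bar>of_int n :: real\<bar> < 1"
    using assms(2) by (simp add: abs_mult)
  then have "n = 0"
    by linarith
  ultimately show ?thesis
    by simp
qed

lemma circle_param_surj:
  assumes "p \<in> sphere z r" "0 < r"
  obtains u where "a \<le> u" "u < a + 2 * pi" "p = z + of_real r * cis u"
proof -
  define x where "x = (p - z) / of_real r"
  have "cmod x = 1"
    using assms by (simp add: x_def norm_divide dist_norm norm_minus_commute)
  then have "x \<noteq> 0" "sgn x = x"
    by (auto simp: sgn_div_norm)
  then have x: "x = cis (Arg x)"
    using cis_Arg by metis
  define k where "k = \<lfloor>(Arg x - a) / (2 * pi)\<rfloor>"
  define u where "u = Arg x - 2 * pi * of_int k"
  have "of_int k \<le> (Arg x - a) / (2 * pi)" "(Arg x - a) / (2 * pi) < of_int k + 1"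
    unfolding k_def by linarith+
  then have "a \<le> u" "u < a + 2 * pi"
    by (auto simp: u_def field_simps)
  have "cis u = cis (Arg x)"
    by (simp add: u_def cis_divide[symmetric] cis_multiple_2pi)
  moreover have "p = z + of_real r * x"
    using assms by (simp add: x_def)
  ultimately have "p = z + of_real r * cis u"
    using x by metis
  with \<open>a \<le> u\<close> \<open>u < a + 2 * pi\<close> show thesis
    by (rule that)
qed

text \<open>Repeating the starting angle one turn later as \<open>\<theta> n\<close> makes every
  arc, the last one included, run from index \<open>i\<close> to \<open>Suc i\<close>. Putting
  \<open>p\<close> first lets later arguments start the cycle at a vertex of their choice.\<close>

lemma circle_points_in_cyclic_order:
  assumes "0 < r" "finite (sphere z r \<inter> M)" "p \<in> sphere z r" "p \<in> M"
  obtains \<theta> :: "nat \<Rightarrow> real" and n where "0 < n" "\<And>i j. i < j \<Longrightarrow> j \<le> n \<Longrightarrow> \<theta> i < \<theta> j"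
    "\<theta> n = \<theta> 0 + 2 * pi" "p = z + of_real r * cis (\<theta> 0)"
    "sphere z r \<inter> M = (\<lambda>i. z + of_real r * cis (\<theta> i)) ` {..<n}"
    "\<And>i u. i < n \<Longrightarrow> \<theta> i < u \<Longrightarrow> u < \<theta> (Suc i) \<Longrightarrow> z + of_real r * cis u \<notin> M"
proof -
  define f where "f u = z + of_real r * cis u" for u
  obtain a where a: "p = f a"
    using circle_param_surj[OF assms(3,1)] unfolding f_def by metis
  define A where "A = {u \<in> {a..<a + 2 * pi}. f u \<in> M}"
  have f_sphere: "f u \<in> sphere z r" for u
    using assms(1) by (simp add: f_def dist_norm norm_mult)
  have "inj_on f {a..<a + 2 * pi}"
  proof (rule inj_onI)
    fix u u' assume "u \<in> {a..<a + 2 * pi}" "u' \<in> {a..<a + 2 * pi}" "f u = f u'"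
    then show "u = u'"
      unfolding f_def by (intro inj_on_circle_param[OF assms(1)]) auto
  qed
  then have "inj_on f A"
    by (rule inj_on_subset) (auto simp: A_def)
  moreover have "f ` A \<subseteq> sphere z r \<inter> M"
    using f_sphere by (auto simp: A_def)
  ultimately have fin: "finite A"
    using assms(2) finite_imageD finite_subset by blast
  have image: "sphere z r \<inter> M = f ` A"
  proof
    show "sphere z r \<inter> M \<subseteq> f ` A"
    proof
      fix q assume "q \<in> sphere z r \<inter> M"
      moreover from this obtain u where "a \<le> u" "u < a + 2 * pi" "q = f u"
        unfolding f_def using circle_param_surj[of q z r a] assms(1) by blast
      ultimately show "q \<in> f ` A"
        by (auto simp: A_def)
    qed
  qed fact
  define n where "n = card A"
  define xs where "xs = sorted_list_of_set A"
  have xs: "set xs = A" "length xs = n" "sorted_wrt (<) xs"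
    using fin by (auto simp: xs_def n_def)
  have "a \<in> A"
    using a assms(4) by (simp add: A_def)
  then have "0 < n"
    using fin by (auto simp: n_def card_gt_0_iff)
  define \<theta> where "\<theta> i = (if i < n then xs ! i else a + 2 * pi)" for i
  have in_A: "\<theta> i \<in> A" if "i < n" for i
    using that xs by (auto simp: \<theta>_def)
  have less: "\<theta> i < \<theta> j" if "i < j" "j \<le> n" for i j
  proof (cases "j < n")
    case True
    then show ?thesis
      using that xs by (auto simp: \<theta>_def sorted_wrt_iff_nth_less)
  next
    case False
    then show ?thesis
      using that in_A[of i] by (auto simp: \<theta>_def A_def)
  qed
  have index: "\<exists>i<n. u = \<theta> i" if "u \<in> A" for u
    using that xs by (metis \<theta>_def in_set_conv_nth)
  have "\<theta> 0 = a"
  proof -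
    obtain i where "i < n" "a = \<theta> i"
      using index[OF \<open>a \<in> A\<close>] by blast
    moreover have "a \<le> \<theta> 0"
      using in_A[OF \<open>0 < n\<close>] by (simp add: A_def)
    ultimately show ?thesis
      using less[of 0 i] by (cases "i = 0") auto
  qed
  show thesis
  proof (rule that[of n \<theta>])
    show "sphere z r \<inter> M = (\<lambda>i. z + of_real r * cis (\<theta> i)) ` {..<n}"
      unfolding image using in_A index by (auto simp: f_def)
    show "z + of_real r * cis u \<notin> M" if "i < n" "\<theta> i < u" "u < \<theta> (Suc i)" for i u
    proof
      assume "z + of_real r * cis u \<in> M"
      moreover have "a \<le> u"
        using in_A[OF \<open>i < n\<close>] that by (simp add: A_def)
      moreover have "\<theta> (Suc i) \<le> \<theta> n"
        using less[of "Suc i" n] \<open>i < n\<close> by (cases "Suc i = n") auto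
      then have "u < a + 2 * pi"
        using that by (simp add: \<theta>_def)
      ultimately have "u \<in> A"
        by (simp add: A_def f_def)
      then obtain j where j: "j < n" "u = \<theta> j"
        using index by blast
      then show False
        using less[of i j] less[of j i] less[of j "Suc i"] less[of "Suc i" j] that
        by (cases "j \<le> i"; cases "j = i"; cases "j = Suc i") auto
    qed
  qed (use \<open>0 < n\<close> less \<open>\<theta> 0 = a\<close> a in \<open>auto simp: \<theta>_def f_def\<close>)
qed

section \<open>Realizations as edge colourings by circles\<close>

locale circle_realization =
  fixes G :: "('a, 'b) pre_digraph" and C \<phi> \<psi>
  assumes graph: "graph G"
    and system: "circle_system C"
    and bij_verts: "bij_betw \<phi> (verts G) (meeting_points C)"
    and bij_edges: "bij_betw \<psi> (uedges G) (circle_segments C)"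
    and incident: "\<And>e. e \<in> uedges G \<Longrightarrow> \<psi> e \<inter> meeting_points C = \<phi> ` e"
begin

sublocale graph G
  by (rule graph)

lemma uedgeE:
  assumes "e \<in> uedges G"
  obtains u v where "e = {u, v}" "u \<noteq> v" "u \<in> verts G" "v \<in> verts G"
  using assms no_loops by (auto simp: uedges_def arcs_ends_def arc_to_ends_def)

lemma uedge_subset: "e \<in> uedges G \<Longrightarrow> e \<subseteq> verts G"
  by (auto elim: uedgeE)

lemma inj_verts: "inj_on \<phi> (verts G)"
  using bij_verts by (rule bij_betw_imp_inj_on)

lemma vert_eq_iff: "u \<in> verts G \<Longrightarrow> v \<in> verts G \<Longrightarrow> \<phi> u = \<phi> v \<longleftrightarrow> u = v"
  using inj_verts by (auto dest: inj_onD)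

lemma vert_meeting: "v \<in> verts G \<Longrightarrow> \<phi> v \<in> meeting_points C"
  using bij_verts by (auto dest: bij_betw_imp_surj_on)

lemma circleE:
  assumes "c \<in> C"
  obtains z r where "0 < r" "c = sphere z r"
  using assms system by (auto simp: circle_system_def)

lemma circles_eqI:
  assumes "c \<in> C" "d \<in> C" "{p, q, q'} \<subseteq> c \<inter> d" "p \<noteq> q" "p \<noteq> q'" "q \<noteq> q'"
  shows "c = d"
proof -
  obtain z r w s where c: "c = sphere z r" and d: "d = sphere w s"
    using circleE assms(1,2) by metis
  have "z = w"
    by (rule three_common_points[of p z r q q' w s]) (use assms c d in auto)
  moreover have "r = s"
    using assms(3) c d calculation by auto
  ultimately show ?thesis
    using c d by simp
qed

lemma circles_share_at_most_two_verts:
  assumes "c \<in> C" "d \<in> C" "{x, y, w} \<subseteq> verts G" "\<phi> ` {x, y, w} \<subseteq> c \<inter> d"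
    and "x \<noteq> y" "x \<noteq> w" "y \<noteq> w"
  shows "c = d"
  by (rule circles_eqI[of c d "\<phi> x" "\<phi> y" "\<phi> w"]) (use assms in \<open>auto simp: vert_eq_iff\<close>)

text \<open>Circles serve as colours of the edges; geometry enters the combinatorial part through
  cycles of one colour and the bound of two common vertices for two colours.\<close>

definition col :: "'a set \<Rightarrow> complex set" where
  "col e = (SOME c. c \<in> C \<and> \<psi> e \<subseteq> c)"

lemma segment_in_unique_circle:
  assumes "S \<in> circle_segments C"
  shows "\<exists>!c. c \<in> C \<and> S \<subseteq> c"
proof -
  obtain z r s t where S: "S = (\<lambda>u. z + of_real r * cis u) ` {s..t}" and "0 < r" "sphere z r \<in> C"
    and st: "s < t" "t \<le> s + 2 * pi"
    using assms by (auto simp: circle_segments_def)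
  have sub: "S \<subseteq> sphere z r"
    using \<open>0 < r\<close> by (auto simp: S dist_norm norm_mult)
  define f where "f u = z + of_real r * cis u" for u
  have inj: "f u \<noteq> f u'" if "s < u" "u < u'" "u' \<le> t" for u u'
    using inj_on_circle_param[of r u u' z] \<open>0 < r\<close> st that by (auto simp: f_def)
  \<comment> \<open>Together with \<open>t\<close> these give three distinct points of the arc. The
    parameter \<open>s\<close> is avoided, since it gives the same point as \<open>t\<close> if the
    arc is a full circle.\<close>
  define x y where "x = (2 * s + t) / 3" and "y = (s + 2 * t) / 3"
  have xy: "s < x" "x < y" "y < t"
    using st by (auto simp: x_def y_def)
  show ?thesis
  proof (rule ex1I[of _ "sphere z r"])
    show "c = sphere z r" if "c \<in> C \<and> S \<subseteq> c" for c
    proof (rule circles_eqI[of c "sphere z r" "f x" "f y" "f t"])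
      have "{f x, f y, f t} \<subseteq> S"
        using xy by (auto simp: S f_def)
      then show "{f x, f y, f t} \<subseteq> c \<inter> sphere z r"
        using that sub by blast
    qed (use that \<open>sphere z r \<in> C\<close> inj xy in auto)
  qed (use sub \<open>sphere z r \<in> C\<close> in auto)
qed

lemma col_eqI:
  assumes "e \<in> uedges G" "c \<in> C" "\<psi> e \<subseteq> c"
  shows "col e = c"
  using segment_in_unique_circle[of "\<psi> e"] assms bij_edges unfolding col_def
  by (intro some1_equality) (auto dest: bij_betwE)

lemma
  assumes "e \<in> uedges G"
  shows col_in: "col e \<in> C" and edge_subset_col: "\<psi> e \<subseteq> col e"
proof -
  have "\<psi> e \<in> circle_segments C"
    using assms bij_edges by (auto dest: bij_betwE)
  then have "\<exists>c. c \<in> C \<and> \<psi> e \<subseteq> c"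
    using segment_in_unique_circle by blast
  from someI_ex[OF this] show "col e \<in> C" "\<psi> e \<subseteq> col e"
    unfolding col_def by auto
qed

lemma vert_on_col: "e \<in> uedges G \<Longrightarrow> v \<in> e \<Longrightarrow> \<phi> v \<in> col e"
  using edge_subset_col incident by blast

text \<open>
  Cycles of length one or two are excluded because \<open>G\<close> is simple.
\<close>

lemma circle_cycle:
  assumes "c \<in> C" "v \<in> verts G" "\<phi> v \<in> c"
  obtains z r \<theta> n and x :: "nat \<Rightarrow> 'a" where "0 < r" "c = sphere z r" "3 \<le> n"
    "\<And>i j. i < j \<Longrightarrow> j \<le> n \<Longrightarrow> \<theta> i < \<theta> j" "\<theta> n = \<theta> 0 + 2 * pi"
    "x 0 = v" "x n = v" "inj_on x {..<n}"
    "\<And>i. i \<le> n \<Longrightarrow> \<phi> (x i) = z + of_real r * cis (\<theta> i)"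
    "{u \<in> verts G. \<phi> u \<in> c} = x ` {..<n}"
    "{e \<in> uedges G. col e = c} = (\<lambda>i. {x i, x (Suc i)}) ` {..<n}"
proof -
  obtain z r where "0 < r" and c: "c = sphere z r"
    using circleE \<open>c \<in> C\<close> by metis
  define M where "M = meeting_points C"
  define f where "f u = z + of_real r * cis u" for u
  have "finite M"
    using bij_verts by (metis M_def bij_betw_finite finite_verts)
  then have fin: "finite (sphere z r \<inter> M)"
    by simp
  have "\<phi> v \<in> sphere z r" "\<phi> v \<in> M"
    using assms c by (auto simp: M_def vert_meeting)
  from circle_points_in_cyclic_order[OF \<open>0 < r\<close> fin this]
  obtain \<theta> n where "0 < n" and less: "\<And>i j. i < j \<Longrightarrow> j \<le> n \<Longrightarrow> \<theta> i < \<theta> j"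
    and turn: "\<theta> n = \<theta> 0 + 2 * pi" and start: "\<phi> v = f (\<theta> 0)"
    and image: "sphere z r \<inter> M = (\<lambda>i. f (\<theta> i)) ` {..<n}"
    and gap: "\<And>i u. i < n \<Longrightarrow> \<theta> i < u \<Longrightarrow> u < \<theta> (Suc i) \<Longrightarrow> f u \<notin> M"
    unfolding f_def by metis
  have period: "f (u + 2 * pi * of_int k) = f u" for u k
    by (simp add: f_def cis_mult[symmetric] cis_multiple_2pi)
  have f_c: "f u \<in> sphere z r" for u
    using \<open>0 < r\<close> by (simp add: f_def dist_norm norm_mult)
  have inj_f: "u = u'" if "f u = f u'" "\<bar>u - u'\<bar> < 2 * pi" for u u'
    using inj_on_circle_param[OF \<open>0 < r\<close> that(2)] that(1) by (simp add: f_def)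
  have M: "f (\<theta> i) \<in> M" if "i \<le> n" for i
  proof (cases "i < n")
    case False
    then have "f (\<theta> i) = f (\<theta> 0)"
      using that turn period[of "\<theta> 0" 1] by simp
    then show ?thesis
      using image \<open>0 < n\<close> by auto
  qed (use image in auto)
  define x where "x i = inv_into (verts G) \<phi> (f (\<theta> i))" for i
  have verts_image: "\<phi> ` verts G = M"
    using bij_verts by (simp add: M_def bij_betw_imp_surj_on)
  have x: "\<phi> (x i) = f (\<theta> i)" "x i \<in> verts G" if "i \<le> n" for i
    using M[OF that] by (simp_all add: x_def f_inv_into_f inv_into_into verts_image)
  have "x 0 = v"
    using start x[of 0] vert_eq_iff[of "x 0" v] \<open>v \<in> verts G\<close> by simp
  moreover have "x n = x 0"
    using x[of n] x[of 0] vert_eq_iff[of "x n" "x 0"] turn period[of "\<theta> 0" 1] by simp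
  ultimately have "x n = v"
    by simp
  have inj: "inj_on x {..<n}"
  proof (rule linorder_inj_onI')
    fix i j assume ij: "i \<in> {..<n}" "j \<in> {..<n}" "i < j"
    have "\<theta> 0 \<le> \<theta> i" "\<theta> i < \<theta> j" "\<theta> j < \<theta> n"
      using less[of 0 i] less[of i j] less[of j n] ij by (cases "i = 0"; auto)+
    then have "f (\<theta> i) \<noteq> f (\<theta> j)"
      using inj_f[of "\<theta> i" "\<theta> j"] turn by auto
    then show "x i \<noteq> x j"
      using x(1)[of i] x(1)[of j] ij by auto
  qed
  have on_c: "{u \<in> verts G. \<phi> u \<in> c} = x ` {..<n}"
  proof
    show "{u \<in> verts G. \<phi> u \<in> c} \<subseteq> x ` {..<n}"
    proof
      fix u assume u: "u \<in> {u \<in> verts G. \<phi> u \<in> c}"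
      then have "\<phi> u \<in> (\<lambda>i. f (\<theta> i)) ` {..<n}"
        using image c by (auto simp: M_def vert_meeting)
      then obtain i where "i < n" "\<phi> u = \<phi> (x i)"
        using x(1) by force
      then have "u = x i"
        using u x(2)[of i] by (simp add: vert_eq_iff)
      then show "u \<in> x ` {..<n}"
        using \<open>i < n\<close> by blast
    qed
    show "x ` {..<n} \<subseteq> {u \<in> verts G. \<phi> u \<in> c}"
      using x f_c c by force
  qed
  have edge: "{x i, x (Suc i)} \<in> uedges G \<and> \<psi> {x i, x (Suc i)} = f ` {\<theta> i..\<theta> (Suc i)}" if "i < n" for i
  proof -
    have le: "\<theta> 0 \<le> \<theta> i" "\<theta> i < \<theta> (Suc i)" "\<theta> (Suc i) \<le> \<theta> n"
      using less[of 0 i] less[of i "Suc i"] less[of "Suc i" n] that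
      by (cases "i = 0"; cases "Suc i = n"; auto)+
    have "f ` {\<theta> i..\<theta> (Suc i)} \<in> circle_segments C"
      unfolding circle_segments_def mem_Collect_eq
      by (rule exI[of _ z], rule exI[of _ r], rule exI[of _ "\<theta> i"], rule exI[of _ "\<theta> (Suc i)"])
        (use \<open>0 < r\<close> \<open>c \<in> C\<close> c le turn M[of i] M[of "Suc i"] gap that in \<open>auto simp: f_def M_def\<close>)
    then obtain e where e: "e \<in> uedges G" "\<psi> e = f ` {\<theta> i..\<theta> (Suc i)}"
      using bij_edges by (metis (no_types, lifting) bij_betw_imp_surj_on imageE)
    have "f ` {\<theta> i..\<theta> (Suc i)} \<inter> M = {f (\<theta> i), f (\<theta> (Suc i))}"
    proof
      show "f ` {\<theta> i..\<theta> (Suc i)} \<inter> M \<subseteq> {f (\<theta> i), f (\<theta> (Suc i))}"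
        using gap[OF that] by (force simp: less_le)
    qed (use le M[of i] M[of "Suc i"] that in auto)
    then have "\<phi> ` e = \<phi> ` {x i, x (Suc i)}"
      using incident[OF e(1)] e(2) x(1)[of i] x(1)[of "Suc i"] that by (simp add: M_def)
    then have "e = {x i, x (Suc i)}"
      using inj_on_image_eq_iff[OF inj_verts uedge_subset[OF e(1)], of "{x i, x (Suc i)}"]
        x(2)[of i] x(2)[of "Suc i"] that by simp
    then show ?thesis
      using e by simp
  qed
  have "n \<noteq> 1"
    using edge[of 0] \<open>x n = x 0\<close> by (auto elim!: uedgeE)
  moreover have "n \<noteq> 2"
  proof
    assume "n = 2"
    \<comment> \<open>Both arcs join the same two vertices, so they are the image of the same edge.
      The midpoint of the first arc refutes this.\<close>
    then have "f ` {\<theta> 0..\<theta> 1} = f ` {\<theta> 1..\<theta> 2}"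
      using edge[of 0] edge[of 1] \<open>x n = x 0\<close> by (simp add: numeral_2_eq_2 insert_commute)
    moreover have "\<theta> 0 < \<theta> 1" "\<theta> 1 < \<theta> 2"
      using less \<open>n = 2\<close> by auto
    moreover define u where "u = (\<theta> 0 + \<theta> 1) / 2"
    ultimately have "f u \<in> f ` {\<theta> 1..\<theta> 2}" "\<theta> 0 < u" "u < \<theta> 1"
      by (auto simp: u_def)
    then obtain u' where "f u = f u'" "\<theta> 1 \<le> u'" "u' \<le> \<theta> 2"
      by auto
    then show False
      using inj_f[of u u'] \<open>\<theta> 0 < u\<close> \<open>u < \<theta> 1\<close> turn \<open>n = 2\<close> by auto
  qed
  ultimately have "3 \<le> n"
    using \<open>0 < n\<close> by simp
  have edges: "{e \<in> uedges G. col e = c} = (\<lambda>i. {x i, x (Suc i)}) ` {..<n}"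
  proof
    show "(\<lambda>i. {x i, x (Suc i)}) ` {..<n} \<subseteq> {e \<in> uedges G. col e = c}"
    proof
      fix e assume "e \<in> (\<lambda>i. {x i, x (Suc i)}) ` {..<n}"
      then obtain i where i: "i < n" "e = {x i, x (Suc i)}"
        by blast
      then have "e \<in> uedges G" "\<psi> e = f ` {\<theta> i..\<theta> (Suc i)}"
        using edge by simp_all
      moreover from this have "\<psi> e \<subseteq> c"
        using f_c c by auto
      ultimately show "e \<in> {e \<in> uedges G. col e = c}"
        using col_eqI \<open>c \<in> C\<close> by simp
    qed
    show "{e \<in> uedges G. col e = c} \<subseteq> (\<lambda>i. {x i, x (Suc i)}) ` {..<n}"
    proof
      fix e assume "e \<in> {e \<in> uedges G. col e = c}"
      then have e: "e \<in> uedges G" "col e = c"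
        by auto
      then have "\<psi> e \<in> circle_segments C"
        using bij_edges by (auto dest: bij_betwE)
      then obtain z' r' s t where S: "\<psi> e = (\<lambda>u. z' + of_real r' * cis u) ` {s..t}"
        and "0 < r'" "sphere z' r' \<in> C" "s < t"
        and ends: "z' + of_real r' * cis s \<in> M" "z' + of_real r' * cis t \<in> M"
        and inner: "\<forall>u\<in>{s<..<t}. z' + of_real r' * cis u \<notin> M"
        by (auto simp: circle_segments_def M_def)
      have "\<psi> e \<subseteq> sphere z' r'"
        using \<open>0 < r'\<close> by (auto simp: S dist_norm norm_mult)
      then have "sphere z r = sphere z' r'"
        using col_eqI[OF e(1) \<open>sphere z' r' \<in> C\<close>] e(2) c by simp
      then have z': "z' = z" "r' = r"
        using sphere_eqD \<open>0 < r\<close> by metis+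
      have "f s \<in> (\<lambda>i. f (\<theta> i)) ` {..<n}"
        using ends(1) f_c unfolding image[symmetric] z' by (simp add: f_def)
      then obtain i where i: "i < n" "f s = f (\<theta> i)"
        by auto
      then have "sin s = sin (\<theta> i)" "cos s = cos (\<theta> i)"
        using \<open>0 < r\<close> by (auto simp: f_def complex_eq_iff)
      then obtain k :: int where k: "\<theta> i = s + 2 * pi * of_int k"
        using sin_cos_eq_iff[of "\<theta> i" s] by (auto simp: mult_ac)
      \<comment> \<open>The given parametrisation may differ from \<open>\<theta>\<close> by full
        turns; after the shift the arc starts exactly at \<open>\<theta> i\<close>.\<close>
      define t' where "t' = t + 2 * pi * of_int k"
      have "{\<theta> i..t'} = (\<lambda>u. u + 2 * pi * of_int k) ` {s..t}"
        by (simp add: k t'_def)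
      then have "f ` {\<theta> i..t'} = f ` {s..t}"
        by (simp only: image_image period)
      moreover have "\<psi> e = f ` {s..t}"
        by (simp add: S z' f_def)
      ultimately have S': "\<psi> e = f ` {\<theta> i..t'}"
        by simp
      have "\<theta> i < t'"
        using \<open>s < t\<close> by (simp add: k t'_def)
      have "f t' \<in> M"
        using ends(2)[unfolded z', folded f_def] by (simp only: t'_def period)
      have inner': "f u \<notin> M" if "\<theta> i < u" "u < t'" for u
        using inner[unfolded z', folded f_def] that period[of "u - 2 * pi * of_int k" k]
        by (auto simp: k t'_def)
      \<comment> \<open>Ending earlier, the arc would end at a point that is no meeting point;
        ending later, it would contain one in its interior.\<close>
      have "\<not> t' < \<theta> (Suc i)"
        using gap[OF i(1) \<open>\<theta> i < t'\<close>] \<open>f t' \<in> M\<close> by blast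
      moreover have "\<not> \<theta> (Suc i) < t'"
        using inner'[OF less[of i "Suc i"]] M[of "Suc i"] i(1) by auto
      ultimately have "t' = \<theta> (Suc i)"
        by simp
      then have "\<psi> e = \<psi> {x i, x (Suc i)}"
        using S' edge[OF i(1)] by simp
      then have "e = {x i, x (Suc i)}"
        using bij_edges e(1) edge[OF i(1)] by (metis bij_betw_imp_inj_on inj_onD)
      then show "e \<in> (\<lambda>i. {x i, x (Suc i)}) ` {..<n}"
        using i(1) by blast
    qed
  qed
  show thesis
    by (rule that[OF \<open>0 < r\<close> c \<open>3 \<le> n\<close> less turn \<open>x 0 = v\<close> \<open>x n = v\<close> inj _ on_c edges])
      (use x(1) in \<open>auto simp: f_def\<close>)
qed

text \<open>On a cycle started at \<open>v\<close> the edges at \<open>v\<close> are the first and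
  the last one, and \<open>3 \<le> n\<close> keeps them apart.\<close>

lemma circle_edges_at_vert:
  assumes "c \<in> C" "v \<in> verts G" "\<phi> v \<in> c"
  shows "card {e \<in> uedges G. v \<in> e \<and> col e = c} = 2"
proof -
  obtain n and x :: "nat \<Rightarrow> 'a" where inj: "inj_on x {..<n}" and n: "3 \<le> n"
    and edges: "{e \<in> uedges G. col e = c} = (\<lambda>i. {x i, x (Suc i)}) ` {..<n}"
    and ends: "x 0 = v" "x n = v"
    by (rule circle_cycle[OF assms]) (rule that; assumption)
  have first: "i = 0" if "i < n" "x i = v" for i
    using inj_onD[OF inj, of i 0] that ends n by auto
  have "{e \<in> uedges G. v \<in> e \<and> col e = c} = {{x 0, x 1}, {x (n - 1), v}}"
  proof
    show "{e \<in> uedges G. v \<in> e \<and> col e = c} \<subseteq> {{x 0, x 1}, {x (n - 1), v}}"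
    proof
      fix e assume e: "e \<in> {e \<in> uedges G. v \<in> e \<and> col e = c}"
      then obtain i where i: "i < n" "e = {x i, x (Suc i)}"
        using edges by blast
      then have "v = x i \<or> v = x (Suc i)"
        using e by auto
      then have "i = 0 \<or> Suc i = n"
        using first[of i] first[of "Suc i"] i(1) by (metis Suc_lessI nat.distinct(1))
      then show "e \<in> {{x 0, x 1}, {x (n - 1), v}}"
        using i ends by auto
    qed
    have "{x 0, x 1} \<in> {e \<in> uedges G. col e = c}" "{x (n - 1), x (Suc (n - 1))} \<in> {e \<in> uedges G. col e = c}"
      unfolding edges using n by auto
    then show "{{x 0, x 1}, {x (n - 1), v}} \<subseteq> {e \<in> uedges G. v \<in> e \<and> col e = c}"
      using ends n by auto
  qed
  moreover have "x 1 \<noteq> x (n - 1)"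
    using inj_onD[OF inj, of 1 "n - 1"] n by auto
  then have "{x 0, x 1} \<noteq> {x (n - 1), v}"
    using ends by (auto simp: doubleton_eq_iff)
  ultimately show ?thesis
    by simp
qed

text \<open>Every colour present at \<open>v\<close> occurs there exactly twice, so each of the four
  edges has exactly one partner. The three cases are the ways of pairing four edges.\<close>

lemma colors_at_vert:
  assumes "v \<in> verts G" and at_v: "{e \<in> uedges G. v \<in> e} = {a, b, c, d}" and "distinct [a, b, c, d]"
  shows "col a = col b \<and> col c = col d \<and> col a \<noteq> col c \<or>
    col a = col c \<and> col b = col d \<and> col a \<noteq> col b \<or>
    col a = col d \<and> col b = col c \<and> col a \<noteq> col b"
proof -
  have *: "(\<Sum>f\<in>{a, b, c, d}. if col f = col e then 1 else 0 :: nat) = 2" if "e \<in> {a, b, c, d}" for e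
  proof -
    have "e \<in> uedges G" "v \<in> e"
      using that at_v by blast+
    then have "card {f \<in> uedges G. v \<in> f \<and> col f = col e} = 2"
      using circle_edges_at_vert assms(1) col_in vert_on_col by simp
    moreover have "{f \<in> uedges G. v \<in> f \<and> col f = col e} = {f \<in> {a, b, c, d}. col f = col e}"
      using at_v by blast
    ultimately have "card {f \<in> {a, b, c, d}. col f = col e} = 2"
      by simp
    then show ?thesis
      by (simp only: card_eq_sum sum.inter_filter finite_insert finite.emptyI)
  qed
  define A B D E where "A = col a" "B = col b" "D = col c" "E = col d"
  note defs = this
  have "of_bool (B = A) + of_bool (D = A) + of_bool (E = A) = (1 :: nat)"
    using *[of a] assms(3) by (simp add: defs of_bool_def)
  moreover have "of_bool (A = B) + of_bool (D = B) + of_bool (E = B) = (1 :: nat)"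
    using *[of b] assms(3) by (simp add: defs of_bool_def)
  moreover have "of_bool (A = D) + of_bool (B = D) + of_bool (E = D) = (1 :: nat)"
    using *[of c] assms(3) by (simp add: defs of_bool_def)
  ultimately have "A = B \<and> D = E \<and> A \<noteq> D \<or> A = D \<and> B = E \<and> A \<noteq> B \<or> A = E \<and> B = D \<and> A \<noteq> B"
    by (cases "A = B"; cases "A = D"; cases "B = D"; cases "D = E"; cases "A = E"; cases "B = E"; simp)
  then show ?thesis
    by (simp only: defs)
qed

text \<open>The whole circle is traversed from \<open>v\<close> along edges of its own colour, and
  none of them leaves \<open>S\<close>. This localises a circle by adjacency alone.\<close>

lemma circle_verts_confined:
  assumes "c \<in> C" "v \<in> S" "v \<in> verts G" "\<phi> v \<in> c"
    and closed: "\<And>u w. u \<in> S \<Longrightarrow> {u, w} \<in> uedges G \<Longrightarrow> col {u, w} = c \<Longrightarrow> w \<in> S"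
    and "u \<in> verts G" "\<phi> u \<in> c"
  shows "u \<in> S"
proof -
  obtain n and x :: "nat \<Rightarrow> 'a" where on_c: "{u \<in> verts G. \<phi> u \<in> c} = x ` {..<n}"
    and edges: "{e \<in> uedges G. col e = c} = (\<lambda>i. {x i, x (Suc i)}) ` {..<n}"
    and "x 0 = v"
    by (rule circle_cycle[OF assms(1,3,4)]) (rule that; assumption)
  have "i < n \<Longrightarrow> x i \<in> S" for i
  proof (induction i)
    case (Suc i)
    then have "{x i, x (Suc i)} \<in> {e \<in> uedges G. col e = c}"
      unfolding edges by auto
    then show ?case
      using closed Suc by auto
  qed (use \<open>x 0 = v\<close> \<open>v \<in> S\<close> in auto)
  then have "x ` {..<n} \<subseteq> S"
    by auto
  moreover have "u \<in> x ` {..<n}"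
    unfolding on_c[symmetric] using assms(6,7) by simp
  ultimately show ?thesis
    by blast
qed

lemma two_edge_cut_same_circle:
  assumes cut: "{e \<in> uedges G. e \<inter> S \<noteq> {} \<and> \<not> e \<subseteq> S} = {e, e'}"
  shows "col e = col e'"
proof (rule ccontr)
  assume neq: "col e \<noteq> col e'"
  define c where "c = col e"
  have e: "e \<in> uedges G" "e \<inter> S \<noteq> {}" "\<not> e \<subseteq> S"
    using cut by blast+
  obtain v where v: "v \<in> e" "v \<in> verts G"
    using e by (auto elim: uedgeE)
  have on_c: "c \<in> C" "\<phi> v \<in> c"
    using e v by (simp_all add: c_def col_in vert_on_col)
  obtain n and x :: "nat \<Rightarrow> 'a" where inj: "inj_on x {..<n}" and n: "3 \<le> n"
    and edges: "{e \<in> uedges G. col e = c} = (\<lambda>i. {x i, x (Suc i)}) ` {..<n}"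
    and ends: "x 0 = v" "x n = v"
    by (rule circle_cycle[OF on_c(1) v(2) on_c(2)]) (rule that; assumption)
  define f where "f i \<longleftrightarrow> x i \<in> S" for i
  have "e \<in> (\<lambda>i. {x i, x (Suc i)}) ` {..<n}"
    unfolding edges[symmetric] using e by (simp add: c_def)
  then obtain i where i: "i < n" "e = {x i, x (Suc i)}"
    by blast
  \<comment> \<open>As \<open>e'\<close> has another colour, the cycle changes sides only at step
    \<open>i\<close>; it could then not return to the side on which it started.\<close>
  have other: "f k = f (Suc k)" if k: "k < n" "k \<noteq> i" for k
  proof (rule ccontr)
    assume "f k \<noteq> f (Suc k)"
    moreover have "{x k, x (Suc k)} \<in> {e \<in> uedges G. col e = c}"
      unfolding edges using k by auto
    ultimately have "{x k, x (Suc k)} \<in> {e, e'}" "col {x k, x (Suc k)} = c"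
      unfolding cut[symmetric] by (auto simp: f_def)
    then have eq: "{x k, x (Suc k)} = {x i, x (Suc i)}"
      using neq i by (auto simp: c_def)
    \<comment> \<open>The only repetition on the closed cycle is that of its first vertex as its
      last.\<close>
    have inj': "j = j' \<or> j = 0 \<and> j' = n \<or> j = n \<and> j' = 0" if "j \<le> n" "j' \<le> n" "x j = x j'" for j j'
    proof -
      have "j < n \<or> j = n" "j' < n \<or> j' = n"
        using that by auto
      then show ?thesis
        using that ends n inj_onD[OF inj, of j j'] inj_onD[OF inj, of 0 j'] inj_onD[OF inj, of j 0] by auto
    qed
    from eq consider "x k = x i" | "x k = x (Suc i)" "x (Suc k) = x i"
      by (auto simp: doubleton_eq_iff)
    then show False
    proof cases
      case 1
      then show ?thesis
        using inj'[of k i] k i(1) by auto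
    next
      case 2
      then show ?thesis
        using inj'[of k "Suc i"] inj'[of "Suc k" i] k i(1) n by auto
    qed
  qed
  have left: "k \<le> i \<Longrightarrow> f k = f 0" for k
  proof (induction k)
    case (Suc k)
    then show ?case
      using other[of k] i(1) by simp
  qed simp
  have "Suc i + k \<le> n \<Longrightarrow> f (Suc i + k) = f (Suc i)" for k
  proof (induction k)
    case (Suc k)
    then show ?case
      using other[of "Suc i + k"] by simp
  qed simp
  from this[of "n - Suc i"] have "f n = f (Suc i)"
    using i(1) by simp
  then have "f i = f (Suc i)"
    using left[of i] ends by (simp add: f_def)
  then show False
    using e(2,3) i(2) by (auto simp: f_def)
qed

lemma colors_at_vert_of_degree_four:
  assumes "v \<in> verts G" "distinct [v, a, b, c, d]"
    and nbrs: "\<And>w. {v, w} \<in> uedges G \<longleftrightarrow> w \<in> {a, b, c, d}"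
  shows "col {v, a} = col {v, b} \<and> col {v, c} = col {v, d} \<and> col {v, a} \<noteq> col {v, c} \<or>
    col {v, a} = col {v, c} \<and> col {v, b} = col {v, d} \<and> col {v, a} \<noteq> col {v, b} \<or>
    col {v, a} = col {v, d} \<and> col {v, b} = col {v, c} \<and> col {v, a} \<noteq> col {v, b}"
proof (rule colors_at_vert[OF assms(1)])
  show "{e \<in> uedges G. v \<in> e} = {{v, a}, {v, b}, {v, c}, {v, d}}"
  proof
    show "{e \<in> uedges G. v \<in> e} \<subseteq> {{v, a}, {v, b}, {v, c}, {v, d}}"
    proof
      fix e assume e: "e \<in> {e \<in> uedges G. v \<in> e}"
      then obtain u u' where "e = {u, u'}"
        by (auto elim: uedgeE)
      then obtain w where "e = {v, w}"
        using e by (cases "v = u") auto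
      then show "e \<in> {{v, a}, {v, b}, {v, c}, {v, d}}"
        using nbrs e by auto
    qed
  qed (use nbrs in auto)
  show "distinct [{v, a}, {v, b}, {v, c}, {v, d}]"
    using assms(2) by (auto simp: doubleton_eq_iff)
qed

lemma two_edge_cut_same_circle':
  assumes cut: "\<And>u w. u \<in> S \<Longrightarrow> w \<notin> S \<Longrightarrow> {u, w} \<in> uedges G \<longleftrightarrow> (u, w) \<in> {(a, x), (b, y)}"
    and "{a, b} \<subseteq> S" "x \<notin> S" "y \<notin> S"
  shows "col {a, x} = col {b, y}"
proof (rule two_edge_cut_same_circle[of S])
  show "{e \<in> uedges G. e \<inter> S \<noteq> {} \<and> \<not> e \<subseteq> S} = {{a, x}, {b, y}}"
  proof
    show "{e \<in> uedges G. e \<inter> S \<noteq> {} \<and> \<not> e \<subseteq> S} \<subseteq> {{a, x}, {b, y}}"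
    proof
      fix e assume e: "e \<in> {e \<in> uedges G. e \<inter> S \<noteq> {} \<and> \<not> e \<subseteq> S}"
      then obtain u w where "e = {u, w}" "u \<in> S" "w \<notin> S"
        by (auto elim!: uedgeE)
      then show "e \<in> {{a, x}, {b, y}}"
        using cut[of u w] e by auto
    qed
  qed (use assms in auto)
qed

text \<open>
  A chord consists of two doubled edges \<open>x = m = y\<close>; one edge of each pair is replaced by a
  gadget with two outgoing edges, so that it still carries a single circle.  If the two edges
  \<open>{x, l}\<close> and \<open>{x, r}\<close> were on different circles, these circles would share
  \<open>x\<close>, \<open>m\<close> and \<open>y\<close>.
\<close>

lemma chord_circles:
  assumes verts: "{x, m, y} \<subseteq> verts G"
    and distinct: "distinct [x, l, r, m, a]" "distinct [m, x, a', y, b]" "distinct [y, l', r', m, b']" "x \<noteq> y"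
    and nbrs: "\<And>w. {x, w} \<in> uedges G \<longleftrightarrow> w \<in> {l, r, m, a}"
      "\<And>w. {m, w} \<in> uedges G \<longleftrightarrow> w \<in> {x, a', y, b}"
      "\<And>w. {y, w} \<in> uedges G \<longleftrightarrow> w \<in> {l', r', m, b'}"
    and cut_A: "\<And>u w. u \<in> A \<Longrightarrow> w \<notin> A \<Longrightarrow> {u, w} \<in> uedges G \<longleftrightarrow> (u, w) \<in> {(a, x), (a', m)}"
    and cut_B: "\<And>u w. u \<in> B \<Longrightarrow> w \<notin> B \<Longrightarrow> {u, w} \<in> uedges G \<longleftrightarrow> (u, w) \<in> {(b, m), (b', y)}"
    and A: "{a, a'} \<subseteq> A" "x \<notin> A" "m \<notin> A"
    and B: "{b, b'} \<subseteq> B" "m \<notin> B" "y \<notin> B"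
  shows "col {x, l} = col {x, r}" "col {x, m} \<noteq> col {x, l}" "col {x, a} = col {x, m}"
    "col {y, l'} = col {y, r'}" "col {m, y} \<noteq> col {y, l'}" "col {y, b'} = col {m, y}"
    "\<And>u. u \<in> verts G \<Longrightarrow> \<phi> u \<in> col {x, m} \<Longrightarrow> u \<in> {x, m} \<union> A"
    "\<And>u. u \<in> verts G \<Longrightarrow> \<phi> u \<in> col {m, y} \<Longrightarrow> u \<in> {m, y} \<union> B"
proof -
  have sym: "col {u, w} = col {w, u}" for u w
    by (simp add: insert_commute)
  have gadget_A: "col {m, a'} = col {x, a}"
    using two_edge_cut_same_circle'[OF cut_A] A by (simp add: insert_commute)
  have gadget_B: "col {y, b'} = col {m, b}"
    using two_edge_cut_same_circle'[OF cut_B] B by (simp add: insert_commute)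
  note at_x = colors_at_vert_of_degree_four[of x, OF _ distinct(1) nbrs(1)]
  note at_m = colors_at_vert_of_degree_four[of m, OF _ distinct(2) nbrs(2)]
  note at_y = colors_at_vert_of_degree_four[of y, OF _ distinct(3) nbrs(3)]
  have same: "col {x, l} = col {x, r}"
  proof (rule ccontr)
    assume neq: "col {x, l} \<noteq> col {x, r}"
    define X Y where "X = col {x, l}" "Y = col {x, r}"
    have "X \<noteq> Y" "X \<in> C" "Y \<in> C" "\<phi> x \<in> X \<inter> Y"
      using neq nbrs(1)[of l] nbrs(1)[of r] by (auto simp: X_Y_def col_in vert_on_col)
    \<comment> \<open>Both colours leave \<open>x\<close> towards \<open>m\<close>, one along the
      edge and one through the gadget. At \<open>m\<close> they use up two edges, so the other two
      carry the same pair on to \<open>y\<close>.\<close>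
    have x: "{col {x, m}, col {x, a}} = {X, Y}"
      using at_x verts neq by (auto simp: X_Y_def)
    then have m: "{col {m, x}, col {m, a'}} = {X, Y}"
      by (simp only: sym[of m x] gadget_A)
    then have m': "{col {m, y}, col {m, b}} = {X, Y}"
      using at_m verts \<open>X \<noteq> Y\<close> by (auto simp: doubleton_eq_iff)
    then have y: "{col {y, m}, col {y, b'}} = {X, Y}"
      by (simp only: sym[of y m] gadget_B)
    have "\<phi> m \<in> X \<inter> Y"
    proof -
      have "\<phi> m \<in> col {m, x}" "\<phi> m \<in> col {m, a'}"
        using nbrs(2) by (auto intro!: vert_on_col)
      then show ?thesis
        using m by (auto simp: doubleton_eq_iff)
    qed
    moreover have "\<phi> y \<in> X \<inter> Y"
    proof -
      have "\<phi> y \<in> col {y, m}" "\<phi> y \<in> col {y, b'}"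
        using nbrs(3) by (auto intro!: vert_on_col)
      then show ?thesis
        using y by (auto simp: doubleton_eq_iff)
    qed
    ultimately have "X = Y"
      using verts distinct \<open>\<phi> x \<in> X \<inter> Y\<close>
      by (intro circles_share_at_most_two_verts[OF \<open>X \<in> C\<close> \<open>Y \<in> C\<close>, of x m y]) auto
    then show False
      using \<open>X \<noteq> Y\<close> by contradiction
  qed
  show "col {x, l} = col {x, r}"
    by fact
  have x: "col {x, m} = col {x, a}" "col {x, l} \<noteq> col {x, m}"
    using at_x same verts by auto
  \<comment> \<open>The two edges of \<open>m\<close> on the side of \<open>x\<close> now have one
    colour, so those on the side of \<open>y\<close> share the other colour at \<open>m\<close>. The
    second half of the chord follows from here.\<close>
  then have m: "col {m, y} = col {m, b}" "col {m, x} \<noteq> col {m, y}"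
    using at_m gadget_A sym[of m x] verts by auto
  then have y: "col {y, l'} = col {y, r'}" "col {y, l'} \<noteq> col {y, m}" "col {y, b'} = col {m, y}"
    using at_y gadget_B sym[of y m] verts by auto
  show "col {x, m} \<noteq> col {x, l}" "col {x, a} = col {x, m}"
    "col {y, l'} = col {y, r'}" "col {m, y} \<noteq> col {y, l'}" "col {y, b'} = col {m, y}"
    using x y sym[of y m] by auto
  show "u \<in> {x, m} \<union> A" if "u \<in> verts G" "\<phi> u \<in> col {x, m}" for u
  \<comment> \<open>At \<open>x\<close> and at \<open>m\<close> both edges of this colour stay in
    the half chord, and the gadget has no other exits.\<close>
  proof (rule circle_verts_confined[OF _ _ _ _ _ that])
    show "w \<in> {x, m} \<union> A" if "v \<in> {x, m} \<union> A" "{v, w} \<in> uedges G" "col {v, w} = col {x, m}" for v w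
    proof -
      from that(1) consider "v = x" | "v = m" | "v \<in> A" "w \<notin> A" | "w \<in> A"
        by blast
      then show ?thesis
      proof cases
        case 1
        then have "w \<in> {l, r, m, a}" "w \<noteq> l" "w \<noteq> r"
          using that(2,3) nbrs(1) x same by auto
        then show ?thesis
          using A by auto
      next
        case 2
        then have "w \<in> {x, a', y, b}" "w \<noteq> y" "w \<noteq> b"
          using that(2,3) nbrs(2) m sym[of m x] by auto
        then show ?thesis
          using A by auto
      qed (use that(2) cut_A in auto)
    qed
  qed (use nbrs(1) verts in \<open>auto intro: col_in vert_on_col\<close>)
  show "u \<in> {m, y} \<union> B" if "u \<in> verts G" "\<phi> u \<in> col {m, y}" for u
  proof (rule circle_verts_confined[OF _ _ _ _ _ that])
    show "w \<in> {m, y} \<union> B" if "v \<in> {m, y} \<union> B" "{v, w} \<in> uedges G" "col {v, w} = col {m, y}" for v w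
    proof -
      from that(1) consider "v = m" | "v = y" | "v \<in> B" "w \<notin> B" | "w \<in> B"
        by blast
      then show ?thesis
      proof cases
        case 1
        then have "w \<in> {x, a', y, b}" "w \<noteq> x" "w \<noteq> a'"
          using that(2,3) nbrs(2) m x gadget_A sym[of m x] by auto
        then show ?thesis
          using B by auto
      next
        case 2
        then have "w \<in> {l', r', m, b'}" "w \<noteq> l'" "w \<noteq> r'"
          using that(2,3) nbrs(3) y sym[of y m] by auto
        then show ?thesis
          using B by auto
      qed (use that(2) cut_B in auto)
    qed
  qed (use nbrs(2) verts in \<open>auto intro: col_in vert_on_col\<close>)
qed

text \<open>Adjacency determines the order of the octagon on \<open>K\<close> only up to direction.
  Replacing \<open>i\<close> by \<open>7 - i\<close> maps the chords to themselves, so either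
  direction yields the same forbidden configuration.\<close>

lemma no_octagon_with_chords:
  fixes k :: "nat \<Rightarrow> 'a" and D :: "nat \<Rightarrow> complex set"
  defines "chords \<equiv> {(0, 3), (1, 6), (2, 5), (4, 7)}"
  assumes K: "K \<in> C" "inj_on k {..<8}" "{u \<in> verts G. \<phi> u \<in> K} = k ` {..<8}"
    and octagon: "\<And>i j. i < 8 \<Longrightarrow> j < 8 \<Longrightarrow> {k i, k j} \<in> uedges G
      \<Longrightarrow> j = Suc i mod 8 \<or> i = Suc j mod 8"
    and D: "\<And>i. i < 8 \<Longrightarrow> D i \<in> C" "\<And>i. i < 8 \<Longrightarrow> D i \<noteq> K" "\<And>i. i < 8 \<Longrightarrow> \<phi> (k i) \<in> D i"
      "\<And>i j. i < 8 \<Longrightarrow> j < 8 \<Longrightarrow> \<phi> (k j) \<in> D i \<Longrightarrow> j = i"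
    and meet: "\<And>i j. (i, j) \<in> chords \<Longrightarrow> D i \<inter> D j \<noteq> {}"
    and apart: "\<And>i j. i < j \<Longrightarrow> j < 8 \<Longrightarrow> (i, j) \<notin> chords \<Longrightarrow> D i \<inter> D j = {}"
  shows False
proof -
  have k: "k i \<in> verts G" "\<phi> (k i) \<in> K" if "i < 8" for i
    using K(3) that by auto
  obtain x n R z \<theta> where inj: "inj_on x {..<n}" and on_K: "{u \<in> verts G. \<phi> u \<in> K} = x ` {..<n}"
    and "0 < R" and Kz: "K = sphere z R"
    and edges: "{e \<in> uedges G. col e = K} = (\<lambda>i. {x i, x (Suc i)}) ` {..<n}"
    and ends: "x 0 = k 0" "x n = k 0" and turn: "\<theta> n = \<theta> 0 + 2 * pi"
    and less: "\<And>i j. i < j \<Longrightarrow> j \<le> n \<Longrightarrow> \<theta> i < \<theta> j"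
    and angle: "\<And>i. i \<le> n \<Longrightarrow> \<phi> (x i) = z + of_real R * cis (\<theta> i)"
    using circle_cycle[OF K(1) k[of 0]] by (smt (verit) zero_less_numeral)
  have "n = 8"
    using card_image[OF inj] card_image[OF K(2)] on_K K(3) by simp
  have "\<exists>w r. 0 < r \<and> D i = sphere w r" if "i < 8" for i
    using circleE D(1)[OF that] by metis
  then obtain w r where r: "0 < r i" and Dw: "D i = sphere (w i) (r i)" if "i < 8" for i
    by metis
  have tangent: "K \<inter> D i = {\<phi> (k i)}" if "i < 8" for i
  proof
    show "K \<inter> D i \<subseteq> {\<phi> (k i)}"
    proof
      \<comment> \<open>A common point of different circles is always a vertex, so knowing the
        vertices on \<open>K\<close> and \<open>D i\<close> settles the whole intersection.\<close>
      fix q assume q: "q \<in> K \<inter> D i"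
      then have "q \<in> meeting_points C"
        using K(1) D(1,2)[OF that] by (auto simp: meeting_points_def)
      then obtain u where "u \<in> verts G" "q = \<phi> u"
        using bij_verts by (auto simp: bij_betw_def)
      then have "u \<in> k ` {..<8}"
        using q K(3) by auto
      then show "q \<in> {\<phi> (k i)}"
        using D(4)[OF that] q \<open>q = \<phi> u\<close> by auto
    qed
  qed (use k D(3) that in auto)
  \<comment> \<open>The renumbering \<open>\<pi>\<close> lists the octagon by increasing angle; it
    will be the identity or the reversal.\<close>
  have contra: False if \<pi>: "\<And>i. i < 8 \<Longrightarrow> \<pi> i < 8" "\<And>i j. (i, j) \<in> chords \<Longrightarrow> D (\<pi> i) \<inter> D (\<pi> j) \<noteq> {}"
      "\<And>i j. i < j \<Longrightarrow> j < 8 \<Longrightarrow> (i, j) \<notin> chords \<Longrightarrow> D (\<pi> i) \<inter> D (\<pi> j) = {}"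
    and a: "\<And>i j. i < j \<Longrightarrow> j < 8 \<Longrightarrow> a i < a j" "a 7 < a 0 + 2 * pi"
      "\<And>i. i < 8 \<Longrightarrow> \<phi> (k (\<pi> i)) = z + of_real R * cis (a i)" for \<pi> a
  proof (rule no_eight_tangent_circles[OF \<open>0 < R\<close> a(1,2)])
    show "sphere z R \<inter> sphere (w (\<pi> i)) (r (\<pi> i)) = {z + of_real R * cis (a i)}" if "i < 8" for i
      using tangent[OF \<pi>(1)[OF that]] Dw[OF \<pi>(1)[OF that]] Kz a(3)[OF that] by simp
    show "sphere (w (\<pi> i)) (r (\<pi> i)) \<noteq> sphere z R" if "i < 8" for i
      using D(2)[OF \<pi>(1)[OF that]] Dw[OF \<pi>(1)[OF that]] Kz by simp
    show "0 < r (\<pi> i)" if "i < 8" for i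
      using r \<pi>(1) that by simp
    show "sphere (w (\<pi> i)) (r (\<pi> i)) \<inter> sphere (w (\<pi> j)) (r (\<pi> j)) \<noteq> {}"
      if "(i, j) \<in> {(0, 3), (1, 6), (2, 5), (4, 7)}" for i j
    proof -
      have "i < 8" "j < 8"
        using that by auto
      then show ?thesis
        using \<pi>(2)[of i j] that Dw[of "\<pi> i"] Dw[of "\<pi> j"] \<pi>(1) by (simp add: chords_def)
    qed
    show "sphere (w (\<pi> i)) (r (\<pi> i)) \<inter> sphere (w (\<pi> j)) (r (\<pi> j)) = {}"
      if "i < j" "j < 8" "(i, j) \<notin> {(0, 3), (1, 6), (2, 5), (4, 7)}" for i j
      using \<pi>(3)[of i j] that Dw[of "\<pi> i"] Dw[of "\<pi> j"] \<pi>(1)[of i] \<pi>(1)[of j] by (simp add: chords_def)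
  qed
  have "\<exists>j<8. x i = k j" if "i \<le> 8" for i
  proof (cases "i < 8")
    case True
    then have "x i \<in> k ` {..<8}"
      using on_K K(3) \<open>n = 8\<close> by blast
    then show ?thesis
      by blast
  qed (use that ends \<open>n = 8\<close> in \<open>auto intro!: exI[of _ 0]\<close>)
  then obtain p where p: "p i < 8" "x i = k (p i)" if "i \<le> 8" for i
    by metis
  have p0: "p 0 = 0"
    using p[of 0] ends inj_onD[OF K(2), of "p 0" 0] by simp
  have p8: "p 8 = 0"
    using p[of 8] ends \<open>n = 8\<close> inj_onD[OF K(2), of "p 8" 0] by simp
  have pinj: "p i \<noteq> p j" if "i < j" "j < 8" for i j
    using inj_onD[OF inj, of i j] p[of i] p[of j] that \<open>n = 8\<close> by auto
  have step: "p (Suc i) = Suc (p i) mod 8 \<or> p i = Suc (p (Suc i)) mod 8" if "i < 8" for i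
  proof -
    have "{x i, x (Suc i)} \<in> {e \<in> uedges G. col e = K}"
      unfolding edges using that \<open>n = 8\<close> by auto
    then show ?thesis
      using octagon[of "p i" "p (Suc i)"] p[of i] p[of "Suc i"] that by auto
  qed
  have Suc_mod_inj: "a = b" if "Suc a mod 8 = Suc b mod 8" "a < 8" "b < 8" for a b :: nat
    using that by (auto simp: mod_Suc split: if_splits)
  \<comment> \<open>Turning round would revisit the preceding vertex, so the direction of the first
    step persists.\<close>
  have forward: "p (Suc (Suc i)) = Suc (p (Suc i)) mod 8"
    if "Suc (Suc i) < 8" "p (Suc i) = Suc (p i) mod 8" for i
    using step[of "Suc i"] Suc_mod_inj[of "p i" "p (Suc (Suc i))"] p(1)[of i] p(1)[of "Suc (Suc i)"]
      pinj[of i "Suc (Suc i)"] that by simp blast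
  have backward: "p (Suc i) = Suc (p (Suc (Suc i))) mod 8"
    if "Suc (Suc i) < 8" "p i = Suc (p (Suc i)) mod 8" for i
    using step[of "Suc i"] pinj[of i "Suc (Suc i)"] that by simp
  have "p (Suc 0) = Suc (p 0) mod 8 \<or> p 0 = Suc (p (Suc 0)) mod 8"
    by (rule step) simp
  then show False
  proof
    assume p1: "p (Suc 0) = Suc (p 0) mod 8"
    have "Suc i < 8 \<Longrightarrow> p (Suc i) = Suc (p i) mod 8" for i
      by (induction i) (use p1 forward in auto)
    then have pi: "i < 8 \<Longrightarrow> p i = i" for i
      by (induction i) (use p0 in auto)
    show False
    proof (rule contra[of "\<lambda>i. i" \<theta>])
      show "\<phi> (k i) = z + of_real R * cis (\<theta> i)" if "i < 8" for i
        using angle[of i] p[of i] pi[of i] that \<open>n = 8\<close> by simp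
      show "\<theta> 7 < \<theta> 0 + 2 * pi"
        using less[of 7 8] turn \<open>n = 8\<close> by simp
    qed (use meet apart less \<open>n = 8\<close> in auto)
  next
    assume p1: "p 0 = Suc (p (Suc 0)) mod 8"
    have p': "Suc i < 8 \<Longrightarrow> p i = Suc (p (Suc i)) mod 8" for i
      by (induction i) (use p1 backward in auto)
    have pi: "i < 7 \<Longrightarrow> p (Suc i) = 7 - i" for i
    proof (induction i)
      case 0
      then show ?case
        using p'[of 0] p0 p(1)[of "Suc 0"] by (auto simp: mod_Suc split: if_splits)
    next
      case (Suc i)
      then have "p (Suc i) = 7 - i" "p (Suc i) = Suc (p (Suc (Suc i))) mod 8" "p (Suc (Suc i)) < 8"
        using p'[of "Suc i"] p(1)[of "Suc (Suc i)"] by auto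
      then show ?case
        using Suc.prems by (auto simp: mod_Suc split: if_splits)
    qed
    show False
    \<comment> \<open>In the reversed case the cycle continues after \<open>k 0\<close> with
      \<open>k 7\<close>, and \<open>k 0\<close> comes last, at index 8. Hence the angles are
      shifted by one.\<close>
    proof (rule contra[of "\<lambda>i. 7 - i" "\<lambda>i. \<theta> (Suc i)"])
      show "\<phi> (k (7 - i)) = z + of_real R * cis (\<theta> (Suc i))" if "i < 8" for i
        using angle[of "Suc i"] p[of "Suc i"] pi[of i] p8 that \<open>n = 8\<close> by (cases "i = 7") auto
      show "\<theta> (Suc 7) < \<theta> (Suc 0) + 2 * pi"
        using less[of 0 1] turn \<open>n = 8\<close> by simp
      show "D (7 - i) \<inter> D (7 - j) \<noteq> {}" if "(i, j) \<in> chords" for i j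
        using meet[of "7 - j" "7 - i"] that by (auto simp: chords_def Int_commute)
      show "D (7 - i) \<inter> D (7 - j) = {}" if "i < j" "j < 8" "(i, j) \<notin> chords" for i j
      proof -
        have "(7 - j, 7 - i) \<notin> chords"
          using that by (auto simp: chords_def)
        then show ?thesis
          using apart[of "7 - j" "7 - i"] that by (simp add: Int_commute)
      qed
    qed (use less \<open>n = 8\<close> in auto)
  qed
qed

end

section \<open>Biconnectedness and planarity from finite data\<close>

lemma connected_if_reachable:
  assumes "wf_digraph H" "symmetric H" "r \<in> verts H" "\<And>v. v \<in> verts H \<Longrightarrow> v \<rightarrow>\<^sup>*\<^bsub>H\<^esub> r"
  shows "Digraph_Component.connected H"
proof -
  interpret wf_digraph H by fact
  have "u \<rightarrow>\<^sup>*\<^bsub>H\<^esub> v" if "u \<in> verts H" "v \<in> verts H" for u v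
    using assms(4) that symmetric_reachable[OF assms(2)] reachable_trans by blast
  then show ?thesis
    using assms(3) by (intro connectedI reachable_mk_symmetricI) auto
qed

text \<open>
  The hypotheses say that the identity is an st-numbering: after deleting \<open>v\<close>, the smaller
  vertices reach \<open>0\<close>, the larger ones reach \<open>n\<close>, and these two are adjacent.
\<close>

lemma biconnected_if_st_numbering:
  fixes G :: "(nat, 'b) pre_digraph"
  assumes "graph G" and verts: "verts G = {..n}" and "2 \<le> n"
    and down: "\<And>v. 0 < v \<Longrightarrow> v \<le> n \<Longrightarrow> \<exists>u<v. (v, u) \<in> arcs_ends G"
    and up: "\<And>v. v < n \<Longrightarrow> \<exists>u. v < u \<and> u \<le> n \<and> (v, u) \<in> arcs_ends G"
    and ends: "(n, 0) \<in> arcs_ends G"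
  shows "biconnected G"
proof -
  interpret graph G by fact
  have "v \<rightarrow>\<^sup>*\<^bsub>G\<^esub> 0" if "v \<le> n" for v
    using that
  proof (induction v rule: less_induct)
    case (less v)
    show ?case
    proof (cases "v = 0")
      case False
      then obtain u where "u < v" "(v, u) \<in> arcs_ends G"
        using down less.prems by blast
      then show ?thesis
        using less.IH[of u] less.prems adj_reachable_trans by simp
    qed (use verts in simp)
  qed
  then have "Digraph_Component.connected G"
    using verts by (intro connected_if_reachable[of _ 0] wf_digraph sym_arcs) auto
  moreover have "Digraph_Component.connected (del_vert v)" if "v \<in> verts G" for v
  proof -
    define H where "H = del_vert v"
    interpret H: wf_digraph H
      unfolding H_def by (rule wf_digraph_del_vert)
    have H: "verts H = {..n} - {v}"
      using verts by (simp add: H_def verts_del_vert)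
    have arcs: "arcs_ends H = {(a, b) \<in> arcs_ends G. a \<noteq> v \<and> b \<noteq> v}"
      by (auto simp: H_def arcs_ends_def arc_to_ends_def del_vert_simps)
    have "sym (arcs_ends G)"
      using sym_arcs by (simp add: symmetric_def)
    then have "symmetric H"
      unfolding symmetric_def arcs by (auto intro!: symI dest: symD)
    have low: "u \<rightarrow>\<^sup>*\<^bsub>H\<^esub> 0" if "u < v" "u \<le> n" for u
      using that
    proof (induction u rule: less_induct)
      case (less u)
      show ?case
      proof (cases "u = 0")
        case False
        then obtain w where "w < u" "(u, w) \<in> arcs_ends G"
          using down less.prems by blast
        then show ?thesis
          using less.IH[of w] less.prems H.adj_reachable_trans[of u w] by (simp add: arcs)
      qed (use H less.prems in simp)
    qed
    have high: "u \<rightarrow>\<^sup>*\<^bsub>H\<^esub> n" if "v < u" "u \<le> n" for u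
      using that
    proof (induction "n - u" arbitrary: u rule: less_induct)
      case less
      show ?case
      proof (cases "u = n")
        case False
        then obtain w where "u < w" "w \<le> n" "(u, w) \<in> arcs_ends G"
          using up[of u] less.prems by auto
        then show ?thesis
          using less.hyps[of w] less.prems H.adj_reachable_trans[of u w] by (simp add: arcs)
      qed (use H less.prems in simp)
    qed
    \<comment> \<open>The common target is \<open>0\<close> unless that vertex is deleted; in this
      case every remaining vertex lies above \<open>v\<close> and reaches \<open>n\<close>.\<close>
    have "u \<rightarrow>\<^sup>*\<^bsub>H\<^esub> (if v = 0 then n else 0)" if u: "u \<in> verts H" for u
    proof (cases "u < v")
      case True
      then show ?thesis
        using low u H by simp
    next
      case False
      then have "v < u" "u \<le> n"
        using u H by auto
      then have n: "u \<rightarrow>\<^sup>*\<^bsub>H\<^esub> n"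
        by (rule high)
      show ?thesis
      proof (cases "v = 0")
        case False
        then have "(n, 0) \<in> arcs_ends H"
          using ends \<open>v < u\<close> \<open>u \<le> n\<close> by (simp add: arcs)
        then show ?thesis
          using n H.reachable_adj_trans False by simp
      qed (use n in simp)
    qed
    moreover have "(if v = 0 then n else 0) \<in> verts H"
      using H \<open>2 \<le> n\<close> by auto
    ultimately show ?thesis
      unfolding H_def[symmetric] using \<open>symmetric H\<close> H.wf_digraph by (intro connected_if_reachable) auto
  qed
  ultimately show ?thesis
    using verts \<open>2 \<le> n\<close> by (simp add: biconnected_def)
qed

section \<open>Straight-line drawings tested by integer orientations\<close>

definition orient :: "int \<times> int \<Rightarrow> int \<times> int \<Rightarrow> int \<times> int \<Rightarrow> int" where
  "orient p q r = (fst q - fst p) * (snd r - snd p) - (snd q - snd p) * (fst r - fst p)"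

definition point :: "int \<times> int \<Rightarrow> complex" where
  "point p = Complex (of_int (fst p)) (of_int (snd p))"

text \<open>Twice the signed area of the triangle \<open>p\<close>, \<open>q\<close>,
  \<open>r\<close>. It carries the geometric arguments, while its counterpart \<open>orient\<close>
  is evaluated on concrete integer coordinates.\<close>

definition cross :: "complex \<Rightarrow> complex \<Rightarrow> complex \<Rightarrow> real" where
  "cross p q r = (Re q - Re p) * (Im r - Im p) - (Im q - Im p) * (Re r - Re p)"

lemma cross_point: "cross (point p) (point q) (point r) = of_int (orient p q r)"
  by (simp add: cross_def orient_def point_def)

lemma point_eq_iff: "point p = point q \<longleftrightarrow> p = q"
  by (auto simp: point_def complex_eq_iff prod_eq_iff)

lemma cross_affine:
  "cross p q ((1 - u) *\<^sub>R r + u *\<^sub>R s) = (1 - u) * cross p q r + u * cross p q s"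
  by (simp add: cross_def algebra_simps)

lemma cross_closed_segment:
  assumes "x \<in> closed_segment p q"
  shows "cross p q x = 0"
proof -
  obtain u where "x = (1 - u) *\<^sub>R p + u *\<^sub>R q"
    using assms by (auto simp: in_segment)
  then show ?thesis
    by (simp only: cross_affine) (simp add: cross_def)
qed

text \<open>Both \<open>r\<close> and \<open>s\<close> lie strictly on one side of the line through
  \<open>p\<close> and \<open>q\<close>, and by affinity so does everything between them.\<close>

lemma closed_segments_disjoint:
  assumes "0 < cross p q r * cross p q s"
  shows "closed_segment p q \<inter> closed_segment r s = {}"
proof (rule equals0I)
  fix x assume x: "x \<in> closed_segment p q \<inter> closed_segment r s"
  then obtain u where u: "0 \<le> u" "u \<le> 1" "x = (1 - u) *\<^sub>R r + u *\<^sub>R s"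
    by (auto simp: in_segment)
  have "(1 - u) * cross p q r + u * cross p q s = 0"
    using cross_closed_segment[of x p q] x u(3) cross_affine by auto
  moreover have "(1 - u) * cross p q r + u * cross p q s \<noteq> 0"
  proof (cases "0 < cross p q r")
    case True
    then have "0 < cross p q s"
      using assms by (simp add: zero_less_mult_iff)
    then show ?thesis
      using True u convex_bound_lt[of "- cross p q r" 0 "- cross p q s" "1 - u" u] by simp
  next
    case False
    then have "cross p q r < 0" "cross p q s < 0"
      using assms by (auto simp: zero_less_mult_iff)
    then show ?thesis
      using u convex_bound_lt[of "cross p q r" 0 "cross p q s" "1 - u" u] by simp
  qed
  ultimately show False
    by contradiction
qed

lemma closed_segments_meet_in_end_point:
  assumes "cross p q r \<noteq> 0"
  shows "closed_segment p q \<inter> closed_segment p r = {p}"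
proof
  show "closed_segment p q \<inter> closed_segment p r \<subseteq> {p}"
  proof
    fix x assume x: "x \<in> closed_segment p q \<inter> closed_segment p r"
    then obtain u where u: "x = (1 - u) *\<^sub>R p + u *\<^sub>R r"
      by (auto simp: in_segment)
    have "(1 - u) * cross p q p + u * cross p q r = 0"
      using cross_closed_segment[of x p q] x u cross_affine by auto
    then have "u = 0"
      using assms by (simp add: cross_def)
    then show "x \<in> {p}"
      using u by simp
  qed
qed auto

section \<open>Graphs given by edge lists\<close>

definition list_graph :: "nat \<Rightarrow> (nat \<times> nat) list \<Rightarrow> (nat, nat \<times> nat) pre_digraph" where
  "list_graph n L = \<lparr>verts = {..n}, arcs = set L \<union> (set L)\<inverse>, tail = fst, head = snd\<rparr>"

lemma arcs_ends_list_graph: "arcs_ends (list_graph n L) = set L \<union> (set L)\<inverse>"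
  by (simp add: list_graph_def arcs_ends_def arc_to_ends_def)

lemma uedge_list_graph_iff: "{u, v} \<in> uedges (list_graph n L) \<longleftrightarrow> (u, v) \<in> set L \<or> (v, u) \<in> set L"
  by (auto simp: uedges_def arcs_ends_list_graph doubleton_eq_iff)

lemma graph_list_graph:
  assumes "\<And>u v. (u, v) \<in> set L \<Longrightarrow> u \<le> n \<and> v \<le> n \<and> u \<noteq> v"
  shows "graph (list_graph n L)"
proof
  show "symmetric (list_graph n L)"
    unfolding symmetric_def arcs_ends_list_graph by (auto intro: symI)
  fix e assume "e \<in> arcs (list_graph n L)"
  then show "tail (list_graph n L) e \<in> verts (list_graph n L)"
    "head (list_graph n L) e \<in> verts (list_graph n L)"
    "tail (list_graph n L) e \<noteq> head (list_graph n L) e"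
    using assms[of "fst e" "snd e"] assms[of "snd e" "fst e"] by (cases e; auto simp: list_graph_def)+
qed (auto simp: list_graph_def arc_to_ends_def)

definition nbrs :: "('a \<times> 'a) list \<Rightarrow> 'a \<Rightarrow> 'a list" where
  "nbrs L v = map snd (filter (\<lambda>e. fst e = v) (L @ map prod.swap L))"

lemma adjacent_iff_nbrs: "{v, w} \<in> uedges (list_graph n L) \<longleftrightarrow> w \<in> set (nbrs L v)"
  by (force simp: uedge_list_graph_iff nbrs_def)

lemma regular_list_graph:
  assumes "\<And>v. v \<le> n \<Longrightarrow> card (set (nbrs L v)) = k"
  shows "regular k (list_graph n L)"
proof -
  have "out_degree (list_graph n L) v = card (set (nbrs L v))" for v
  proof -
    have "out_arcs (list_graph n L) v = Pair v ` set (nbrs L v)"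
      by (force simp: out_arcs_def list_graph_def nbrs_def)
    then show ?thesis
      by (simp add: out_degree_def card_image inj_on_def)
  qed
  then show ?thesis
    using assms by (simp add: regular_def list_graph_def)
qed

text \<open>A sufficient test that needs only signs: a common end requires non-collinear segments,
  and otherwise the line through one segment must leave the other strictly on one side.\<close>

fun segments_cross_free :: "(int \<times> int) \<times> (int \<times> int) \<Rightarrow> (int \<times> int) \<times> (int \<times> int) \<Rightarrow> bool" where
  "segments_cross_free (a, b) (c, d) \<longleftrightarrow>
    (if a = c then orient a b d \<noteq> 0 else if a = d then orient a b c \<noteq> 0
     else if b = c then orient b a d \<noteq> 0 else if b = d then orient b a c \<noteq> 0
     else 0 < orient a b c * orient a b d \<or> 0 < orient c d a * orient c d b)"

lemma segments_cross_freeD: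
  assumes "segments_cross_free (a, b) (c, d)"
  shows "closed_segment (point a) (point b) \<inter> closed_segment (point c) (point d) \<subseteq>
    point ` ({a, b} \<inter> {c, d})"
proof -
  consider "a = c" "orient a b d \<noteq> 0" | "a = d" "orient a b c \<noteq> 0" | "b = c" "orient b a d \<noteq> 0"
    | "b = d" "orient b a c \<noteq> 0" | "0 < orient a b c * orient a b d" | "0 < orient c d a * orient c d b"
    using assms by (auto split: if_splits)
  then show ?thesis
  proof cases
    case 1
    then show ?thesis
      using closed_segments_meet_in_end_point[of "point a" "point b" "point d"]
      by (simp add: cross_point)
  next
    case 2
    then show ?thesis
      using closed_segments_meet_in_end_point[of "point a" "point b" "point c"]
      by (simp add: cross_point closed_segment_commute)
  next
    case 3
    then show ?thesis
      using closed_segments_meet_in_end_point[of "point b" "point a" "point d"]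
      by (simp add: cross_point closed_segment_commute)
  next
    case 4
    then show ?thesis
      using closed_segments_meet_in_end_point[of "point b" "point a" "point c"]
      by (simp add: cross_point closed_segment_commute)
  next
    case 5
    then have "0 < real_of_int (orient a b c * orient a b d)"
      by (simp only: of_int_0_less_iff)
    then show ?thesis
      using closed_segments_disjoint[of "point a" "point b" "point c" "point d"]
      by (simp add: cross_point)
  next
    case 6
    then have "0 < real_of_int (orient c d a * orient c d b)"
      by (simp only: of_int_0_less_iff)
    then show ?thesis
      using closed_segments_disjoint[of "point c" "point d" "point a" "point b"]
      by (simp add: cross_point Int_commute)
  qed
qed

text \<open>Testing pairs of edges also keeps edges away from foreign vertices: a vertex
  \<open>v\<close> on an edge \<open>e\<close> has a second neighbour, hence an edge other than
  \<open>e\<close> ends at \<open>v\<close>, and the two may meet only in a common end.\<close>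

lemma planar_list_graph:
  fixes pos :: "nat \<Rightarrow> int \<times> int"
  assumes edges: "\<And>u v. (u, v) \<in> set L \<Longrightarrow> u \<le> n \<and> v \<le> n \<and> u \<noteq> v"
    and no_isolated: "\<And>v. v \<le> n \<Longrightarrow> \<exists>u w. u \<noteq> w \<and> {u, w} \<subseteq> set (nbrs L v)"
    and inj: "inj_on pos {..n}"
    and cross_free: "sorted_wrt segments_cross_free (map (map_prod pos pos) L)"
  shows "planar (list_graph n L)"
proof -
  define \<phi> where "\<phi> v = point (pos v)" for v
  define G where "G = list_graph n L"
  define S where "S e = (case e of (u, v) \<Rightarrow> closed_segment (\<phi> u) (\<phi> v))" for e
  have inj_\<phi>: "\<phi> u = \<phi> v \<longleftrightarrow> u = v" if "u \<le> n" "v \<le> n" for u v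
    using that inj by (auto simp: \<phi>_def point_eq_iff dest: inj_onD)
  have uedgeE: "\<exists>u v. e = {u, v} \<and> (u, v) \<in> set L" if "e \<in> uedges G" for e
    using that by (force simp: G_def uedges_def arcs_ends_list_graph)
  have meet: "S (a, b) \<inter> S (c, d) \<subseteq> \<phi> ` ({a, b} \<inter> {c, d})"
    if e: "(a, b) \<in> set L" "(c, d) \<in> set L" "{a, b} \<noteq> {c, d}" for a b c d
  proof -
    obtain i where i: "i < length L" "L ! i = (a, b)"
      using e(1) by (auto simp: in_set_conv_nth)
    obtain j where j: "j < length L" "L ! j = (c, d)"
      using e(2) by (auto simp: in_set_conv_nth)
    have nth: "segments_cross_free (map (map_prod pos pos) L ! i) (map (map_prod pos pos) L ! j)"
      if "i < j" "j < length L" for i j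
      using cross_free that unfolding sorted_wrt_iff_nth_less by simp
    have free: "segments_cross_free (pos a, pos b) (pos c, pos d) \<or> segments_cross_free (pos c, pos d) (pos a, pos b)"
    proof (cases i j rule: linorder_cases)
      case less
      then show ?thesis
        using nth[of i j] i j by (simp del: segments_cross_free.simps)
    next
      case greater
      then show ?thesis
        using nth[of j i] i j by (simp del: segments_cross_free.simps)
    qed (use i j e in auto)
    have "S (a, b) \<inter> S (c, d) \<subseteq> point ` ({pos a, pos b} \<inter> {pos c, pos d})"
      using free segments_cross_freeD[of "pos a" "pos b" "pos c" "pos d"]
        segments_cross_freeD[of "pos c" "pos d" "pos a" "pos b"] unfolding S_def \<phi>_def
      by (auto simp del: segments_cross_free.simps)
    also have "{pos a, pos b} \<inter> {pos c, pos d} = pos ` ({a, b} \<inter> {c, d})"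
      using inj_on_image_Int[OF inj, of "{a, b}" "{c, d}"] edges[OF e(1)] edges[OF e(2)] by simp
    finally show ?thesis
      by (simp add: \<phi>_def image_image)
  qed
  define ends where "ends e = (SOME p. p \<in> set L \<and> e = {fst p, snd p})" for e
  have ends: "ends e \<in> set L \<and> e = {fst (ends e), snd (ends e)}" if "e \<in> uedges G" for e
    unfolding ends_def by (rule someI_ex) (use uedgeE[OF that] in force)
  define \<gamma> where "\<gamma> e = linepath (\<phi> (fst (ends e))) (\<phi> (snd (ends e)))" for e
  have image_\<gamma>: "path_image (\<gamma> e) = S (ends e)" for e
    by (simp add: \<gamma>_def S_def case_prod_unfold)
  have meet': "path_image (\<gamma> e) \<inter> path_image (\<gamma> e') \<subseteq> \<phi> ` (e \<inter> e')"
    if "e \<in> uedges G" "e' \<in> uedges G" "e \<noteq> e'" for e e'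
    using meet[of "fst (ends e)" "snd (ends e)" "fst (ends e')" "snd (ends e')"] ends[OF that(1)] ends[OF that(2)]
      that(3) unfolding image_\<gamma> by simp
  have sub: "e \<subseteq> {..n}" if "e \<in> uedges G" for e
    using uedgeE[OF that] edges by auto
  have "plane_drawing G \<phi> \<gamma>"
    unfolding plane_drawing_def
  proof (intro conjI ballI impI)
    show "inj_on \<phi> (verts G)"
      using inj_\<phi> by (auto intro!: inj_onI simp: G_def list_graph_def)
    fix e assume e: "e \<in> uedges G"
    have "fst (ends e) \<noteq> snd (ends e)" "fst (ends e) \<le> n" "snd (ends e) \<le> n"
      using ends[OF e] edges[of "fst (ends e)" "snd (ends e)"] by auto
    then show "arc (\<gamma> e)"
      by (simp add: \<gamma>_def inj_\<phi> arc_linepath)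
    have "\<phi> ` e = {\<phi> (fst (ends e)), \<phi> (snd (ends e))}"
      using ends[OF e] by (metis image_empty image_insert)
    then show \<gamma>_ends: "{pathstart (\<gamma> e), pathfinish (\<gamma> e)} = \<phi> ` e"
      by (simp add: \<gamma>_def)
    show "path_image (\<gamma> e) \<inter> \<phi> ` verts G = \<phi> ` e"
    proof
      have "\<phi> ` e \<subseteq> path_image (\<gamma> e)"
        unfolding \<gamma>_ends[symmetric] by (simp add: pathstart_in_path_image pathfinish_in_path_image)
      then show "\<phi> ` e \<subseteq> path_image (\<gamma> e) \<inter> \<phi> ` verts G"
        using sub[OF e] by (auto simp: G_def list_graph_def)
      show "path_image (\<gamma> e) \<inter> \<phi> ` verts G \<subseteq> \<phi> ` e"
      proof
        fix x assume x: "x \<in> path_image (\<gamma> e) \<inter> \<phi> ` verts G"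
        then obtain v where v: "v \<le> n" "x = \<phi> v"
          by (auto simp: G_def list_graph_def)
        obtain u w where uw: "u \<noteq> w" "{v, u} \<in> uedges G" "{v, w} \<in> uedges G"
          using no_isolated[OF v(1)] by (auto simp: G_def adjacent_iff_nbrs)
        then obtain w' where e': "{v, w'} \<in> uedges G" "{v, w'} \<noteq> e"
          by (metis doubleton_eq_iff)
        have "\<phi> v \<in> path_image (\<gamma> {v, w'})"
        proof -
          have "ends {v, w'} = (v, w') \<or> ends {v, w'} = (w', v)"
            using ends[OF e'(1)] by (metis doubleton_eq_iff prod.collapse)
          then show ?thesis
            unfolding image_\<gamma> S_def by auto
        qed
        then have "\<phi> v \<in> path_image (\<gamma> e) \<inter> path_image (\<gamma> {v, w'})"
          using x v(2) by simp
        then have "\<phi> v \<in> \<phi> ` (e \<inter> {v, w'})"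
          using meet'[OF e e'(1) e'(2)[symmetric]] by (rule subsetD[rotated])
        then show "x \<in> \<phi> ` e"
          using v(2) by blast
      qed
    qed
    show "path_image (\<gamma> e) \<inter> path_image (\<gamma> e') \<subseteq> \<phi> ` verts G" if "e' \<in> uedges G" "e \<noteq> e'" for e'
      using meet'[OF e that] sub[OF e] by (auto simp: G_def list_graph_def)
  qed
  then show ?thesis
    unfolding planar_def G_def by blast
qed

section \<open>An octagon with four chords\<close>

text \<open>
  The chord at \<open>x\<close> runs from \<open>x\<close> through \<open>x + 7\<close> to \<open>x + 14\<close>; its two gadgets, on the vertices
  \<open>x + 1, \<dots>, x + 6\<close> and \<open>x + 8, \<dots>, x + 13\<close>, are octahedra with one edge removed.  Two of the
  chords are drawn inside the octagon and two outside.
\<close>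

definition gadget_edges :: "(nat \<times> nat) list" where
  "gadget_edges = [(1, 2), (2, 5), (5, 6), (1, 3), (2, 3), (3, 5), (3, 6), (1, 4), (2, 4), (4, 5), (4, 6)]"

text \<open>In the first gadget the antipodal pairs of the octahedron are 1, 5 and 2, 6 and 3, 4;
  the removed edge joins 1 and 6. The edges \<open>(0, 1)\<close> and \<open>(6, 7)\<close> restore
  degree four there and stand for the second edge between 0 and 7.\<close>

definition chord_edges :: "(nat \<times> nat) list" where
  "chord_edges = [(0, 7), (0, 1), (6, 7), (7, 14), (7, 8), (13, 14)] @
     gadget_edges @ map (\<lambda>(u, v). (7 + u, 7 + v)) gadget_edges"

text \<open>The order is \<open>p\<^sub>1\<close>, \<open>x\<^sub>1\<close>,
  \<open>x\<^sub>2\<close>, \<open>q\<^sub>1\<close>, \<open>q\<^sub>2\<close>,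
  \<open>y\<^sub>2\<close>, \<open>y\<^sub>1\<close>, \<open>p\<^sub>2\<close>; chords join vertices
  that differ by 14. It ends in 59, next to 0, as the st-numbering requires.\<close>

definition octagon :: "nat list" where
  "octagon = [0, 15, 30, 14, 45, 44, 29, 59]"

definition octagon_graph_edges :: "(nat \<times> nat) list" where
  "octagon_graph_edges = concat (map (\<lambda>x. map (\<lambda>(u, v). (x + u, x + v)) chord_edges) [0, 15, 30, 45]) @
     zip octagon (rotate1 octagon)"

lemmas octagon_graph_edges_eq =
  octagon_graph_edges_def[unfolded chord_edges_def gadget_edges_def octagon_def, simplified]

lemmas octagon_graph_int_edges =
  arg_cong[OF octagon_graph_edges_eq, of "map (map_prod int int)", simplified list.map map_prod_simp, simplified]

text \<open>The table is evaluated over \<open>int\<close>, whose numerals are binary, and then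
  carried back along the injection \<open>int\<close>.\<close>

lemma octagon_graph_int_nbrs:
  "map (nbrs (map (map_prod int int) octagon_graph_edges)) [0..59] =
    [[7, 1, 15, 59], [2, 3, 4, 0], [5, 3, 4, 1], [5, 6, 1, 2], [5, 6, 1, 2], [6, 2, 3, 4],
      [7, 5, 3, 4], [14, 8, 0, 6], [9, 10, 11, 7], [12, 10, 11, 8], [12, 13, 8, 9],
      [12, 13, 8, 9], [13, 9, 10, 11], [14, 12, 10, 11], [45, 7, 13, 30], [22, 16, 30, 0],
      [17, 18, 19, 15], [20, 18, 19, 16], [20, 21, 16, 17], [20, 21, 16, 17], [21, 17, 18, 19],
      [22, 20, 18, 19], [29, 23, 15, 21], [24, 25, 26, 22], [27, 25, 26, 23], [27, 28, 23, 24],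
      [27, 28, 23, 24], [28, 24, 25, 26], [29, 27, 25, 26], [59, 22, 28, 44], [37, 31, 14, 15],
      [32, 33, 34, 30], [35, 33, 34, 31], [35, 36, 31, 32], [35, 36, 31, 32], [36, 32, 33, 34],
      [37, 35, 33, 34], [44, 38, 30, 36], [39, 40, 41, 37], [42, 40, 41, 38], [42, 43, 38, 39],
      [42, 43, 38, 39], [43, 39, 40, 41], [44, 42, 40, 41], [29, 37, 43, 45], [52, 46, 44, 14],
      [47, 48, 49, 45], [50, 48, 49, 46], [50, 51, 46, 47], [50, 51, 46, 47], [51, 47, 48, 49],
      [52, 50, 48, 49], [59, 53, 45, 51], [54, 55, 56, 52], [57, 55, 56, 53], [57, 58, 53, 54],
      [57, 58, 53, 54], [58, 54, 55, 56], [59, 57, 55, 56], [0, 52, 58, 29]]"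
  unfolding octagon_graph_int_edges by code_simp

lemma map_nbrs:
  assumes "inj f"
  shows "map f (nbrs L v) = nbrs (map (map_prod f f) L) (f v)"
proof -
  have "map f (map snd (filter (\<lambda>e. fst e = v) M)) =
      map snd (filter (\<lambda>e. fst e = f v) (map (map_prod f f) M))" for M
    by (induction M) (auto simp: inj_eq[OF assms])
  from this[of "L @ map prod.swap L"] show ?thesis
    by (simp add: nbrs_def comp_def prod.swap_def)
qed

lemma octagon_graph_nbrs_nth:
  assumes "v < 60"
  shows "nbrs octagon_graph_edges v =
    map nat (map (nbrs (map (map_prod int int) octagon_graph_edges)) [0..59] ! v)"
proof -
  have "map int (nbrs octagon_graph_edges v) =
      map (nbrs (map (map_prod int int) octagon_graph_edges)) [0..59] ! v"
    using assms by (simp add: map_nbrs)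
  from arg_cong[OF this, of "map nat"] show ?thesis
    by (simp add: comp_def)
qed

lemma octagon_graph_nbrs:
  "nbrs octagon_graph_edges 0 = [7, 1, 15, 59]"
  "nbrs octagon_graph_edges (Suc 0) = [2, 3, 4, 0]"
  "nbrs octagon_graph_edges 2 = [5, 3, 4, 1]"
  "nbrs octagon_graph_edges 3 = [5, 6, 1, 2]"
  "nbrs octagon_graph_edges 4 = [5, 6, 1, 2]"
  "nbrs octagon_graph_edges 5 = [6, 2, 3, 4]"
  "nbrs octagon_graph_edges 6 = [7, 5, 3, 4]"
  "nbrs octagon_graph_edges 7 = [14, 8, 0, 6]"
  "nbrs octagon_graph_edges 8 = [9, 10, 11, 7]"
  "nbrs octagon_graph_edges 9 = [12, 10, 11, 8]"
  "nbrs octagon_graph_edges 10 = [12, 13, 8, 9]"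
  "nbrs octagon_graph_edges 11 = [12, 13, 8, 9]"
  "nbrs octagon_graph_edges 12 = [13, 9, 10, 11]"
  "nbrs octagon_graph_edges 13 = [14, 12, 10, 11]"
  "nbrs octagon_graph_edges 14 = [45, 7, 13, 30]"
  "nbrs octagon_graph_edges 15 = [22, 16, 30, 0]"
  "nbrs octagon_graph_edges 16 = [17, 18, 19, 15]"
  "nbrs octagon_graph_edges 17 = [20, 18, 19, 16]"
  "nbrs octagon_graph_edges 18 = [20, 21, 16, 17]"
  "nbrs octagon_graph_edges 19 = [20, 21, 16, 17]"
  "nbrs octagon_graph_edges 20 = [21, 17, 18, 19]"
  "nbrs octagon_graph_edges 21 = [22, 20, 18, 19]"
  "nbrs octagon_graph_edges 22 = [29, 23, 15, 21]"
  "nbrs octagon_graph_edges 23 = [24, 25, 26, 22]"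
  "nbrs octagon_graph_edges 24 = [27, 25, 26, 23]"
  "nbrs octagon_graph_edges 25 = [27, 28, 23, 24]"
  "nbrs octagon_graph_edges 26 = [27, 28, 23, 24]"
  "nbrs octagon_graph_edges 27 = [28, 24, 25, 26]"
  "nbrs octagon_graph_edges 28 = [29, 27, 25, 26]"
  "nbrs octagon_graph_edges 29 = [59, 22, 28, 44]"
  "nbrs octagon_graph_edges 30 = [37, 31, 14, 15]"
  "nbrs octagon_graph_edges 31 = [32, 33, 34, 30]"
  "nbrs octagon_graph_edges 32 = [35, 33, 34, 31]"
  "nbrs octagon_graph_edges 33 = [35, 36, 31, 32]"
  "nbrs octagon_graph_edges 34 = [35, 36, 31, 32]"
  "nbrs octagon_graph_edges 35 = [36, 32, 33, 34]"
  "nbrs octagon_graph_edges 36 = [37, 35, 33, 34]"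
  "nbrs octagon_graph_edges 37 = [44, 38, 30, 36]"
  "nbrs octagon_graph_edges 38 = [39, 40, 41, 37]"
  "nbrs octagon_graph_edges 39 = [42, 40, 41, 38]"
  "nbrs octagon_graph_edges 40 = [42, 43, 38, 39]"
  "nbrs octagon_graph_edges 41 = [42, 43, 38, 39]"
  "nbrs octagon_graph_edges 42 = [43, 39, 40, 41]"
  "nbrs octagon_graph_edges 43 = [44, 42, 40, 41]"
  "nbrs octagon_graph_edges 44 = [29, 37, 43, 45]"
  "nbrs octagon_graph_edges 45 = [52, 46, 44, 14]"
  "nbrs octagon_graph_edges 46 = [47, 48, 49, 45]"
  "nbrs octagon_graph_edges 47 = [50, 48, 49, 46]"
  "nbrs octagon_graph_edges 48 = [50, 51, 46, 47]"
  "nbrs octagon_graph_edges 49 = [50, 51, 46, 47]"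
  "nbrs octagon_graph_edges 50 = [51, 47, 48, 49]"
  "nbrs octagon_graph_edges 51 = [52, 50, 48, 49]"
  "nbrs octagon_graph_edges 52 = [59, 53, 45, 51]"
  "nbrs octagon_graph_edges 53 = [54, 55, 56, 52]"
  "nbrs octagon_graph_edges 54 = [57, 55, 56, 53]"
  "nbrs octagon_graph_edges 55 = [57, 58, 53, 54]"
  "nbrs octagon_graph_edges 56 = [57, 58, 53, 54]"
  "nbrs octagon_graph_edges 57 = [58, 54, 55, 56]"
  "nbrs octagon_graph_edges 58 = [59, 57, 55, 56]"
  "nbrs octagon_graph_edges 59 = [0, 52, 58, 29]"
  by (subst octagon_graph_nbrs_nth, simp, simp add: octagon_graph_int_nbrs)+

text \<open>The list \<open>ps\<close> draws one chord horizontally with its gadgets above it. The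
  four congruent copies form the top, two upright chords inside the octagon and the bottom; their
  gadgets point up, left, right and down, away from each other.\<close>

definition octagon_graph_points :: "(int \<times> int) list" where
  "octagon_graph_points = (let ps = [(0, 0), (3, 4), (4, 5), (5, 7), (6, 2), (7, 4), (8, 3), (10, - 1),
       (13, 4), (14, 5), (15, 7), (16, 2), (17, 4), (18, 3), (20, 0)]
     in ps @ map (\<lambda>(a, b). (9 - b, - 5 - a)) ps @ map (\<lambda>(a, b). (12 + b, - 5 - a)) ps @
       map (\<lambda>(a, b). (20 - a, - 30 - b)) ps)"

lemmas octagon_graph_points_eq = octagon_graph_points_def[unfolded Let_def, simplified]

lemma distinct_octagon_graph_points: "distinct octagon_graph_points"
  by code_simp

lemmas octagon_graph_segments =
  arg_cong[OF octagon_graph_edges_eq, of "map (map_prod ((!) octagon_graph_points) ((!) octagon_graph_points))",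
    simplified list.map map_prod_simp, simplified octagon_graph_points_eq, simplified]

lemma octagon_graph_cross_free:
  "sorted_wrt segments_cross_free
     (map (map_prod ((!) octagon_graph_points) ((!) octagon_graph_points)) octagon_graph_edges)"
  unfolding octagon_graph_segments by code_simp

definition octagon_graph :: "(nat, nat \<times> nat) pre_digraph" where
  "octagon_graph = list_graph 59 octagon_graph_edges"

lemma octagon_graph_edge_bounds:
  assumes "(u, v) \<in> set octagon_graph_edges"
  shows "u \<le> 59 \<and> v \<le> 59 \<and> u \<noteq> v"
proof -
  have "list_all (\<lambda>(u, v). u \<le> 59 \<and> v \<le> 59 \<and> u \<noteq> v) octagon_graph_edges"
    by (simp add: octagon_graph_edges_eq)
  then show ?thesis
    using assms by (auto simp: list_all_iff)
qed

lemma octagon_graph_nbrs_st: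
  assumes "v \<le> 59"
  shows "card (set (nbrs octagon_graph_edges v)) = 4"
    and "0 < v \<Longrightarrow> \<exists>u\<in>set (nbrs octagon_graph_edges v). u < v"
    and "v < 59 \<Longrightarrow> \<exists>u\<in>set (nbrs octagon_graph_edges v). v < u"
proof -
  have "list_all (\<lambda>v. card (set (nbrs octagon_graph_edges v)) = 4 \<and>
      (0 < v \<longrightarrow> (\<exists>u\<in>set (nbrs octagon_graph_edges v). u < v)) \<and>
      (v < 59 \<longrightarrow> (\<exists>u\<in>set (nbrs octagon_graph_edges v). v < u))) ([0, Suc 0] @ [2..<60])"
    by (simp add: octagon_graph_nbrs)
  moreover have "v \<in> set ([0, Suc 0] @ [2..<60])"
    unfolding set_append set_upt using assms by auto
  ultimately show "card (set (nbrs octagon_graph_edges v)) = 4"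
    "0 < v \<Longrightarrow> \<exists>u\<in>set (nbrs octagon_graph_edges v). u < v"
    "v < 59 \<Longrightarrow> \<exists>u\<in>set (nbrs octagon_graph_edges v). v < u"
    unfolding list_all_iff by blast+
qed

lemma graph_octagon_graph: "graph octagon_graph"
  unfolding octagon_graph_def by (rule graph_list_graph) (rule octagon_graph_edge_bounds)

lemma regular_octagon_graph: "regular 4 octagon_graph"
  unfolding octagon_graph_def by (rule regular_list_graph) (rule octagon_graph_nbrs_st)

lemma octagon_graph_adjacent_iff:
  "{v, w} \<in> uedges octagon_graph \<longleftrightarrow> w \<in> set (nbrs octagon_graph_edges v)"
  unfolding octagon_graph_def by (rule adjacent_iff_nbrs)

lemma biconnected_octagon_graph: "biconnected octagon_graph"
proof (rule biconnected_if_st_numbering[OF graph_octagon_graph, of 59])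
  have arcs: "(v, w) \<in> arcs_ends octagon_graph \<longleftrightarrow> w \<in> set (nbrs octagon_graph_edges v)" for v w
    by (force simp: octagon_graph_def arcs_ends_list_graph nbrs_def)
  show "\<exists>u<v. (v, u) \<in> arcs_ends octagon_graph" if "0 < v" "v \<le> 59" for v
    using octagon_graph_nbrs_st(2)[of v] that by (auto simp: arcs)
  show "\<exists>u. v < u \<and> u \<le> 59 \<and> (v, u) \<in> arcs_ends octagon_graph" if v: "v < 59" for v
  proof -
    obtain u where u: "u \<in> set (nbrs octagon_graph_edges v)" "v < u"
      using octagon_graph_nbrs_st(3)[of v] v by auto
    then have "u \<le> 59"
      using octagon_graph_edge_bounds by (force simp: nbrs_def)
    then show ?thesis
      using u by (auto simp: arcs)
  qed
  show "(59, 0) \<in> arcs_ends octagon_graph"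
    by (simp add: arcs octagon_graph_nbrs)
qed (auto simp: octagon_graph_def list_graph_def)

lemma planar_octagon_graph: "planar octagon_graph"
  unfolding octagon_graph_def
proof (rule planar_list_graph[OF octagon_graph_edge_bounds])
  show "inj_on ((!) octagon_graph_points) {..59}"
    by (rule inj_on_nth[OF distinct_octagon_graph_points]) (simp add: octagon_graph_points_eq)
  show "\<exists>u w. u \<noteq> w \<and> {u, w} \<subseteq> set (nbrs octagon_graph_edges v)" if "v \<le> 59" for v
  proof -
    have "\<not> card (set (nbrs octagon_graph_edges v)) \<le> 1"
      using octagon_graph_nbrs_st(1)[OF that] by simp
    then show ?thesis
      unfolding card_le_Suc0_iff_eq[OF finite_set, folded One_nat_def] by blast
  qed
qed (assumption | rule octagon_graph_cross_free)+

text \<open>Offsets from \<open>x\<close> allow the four chords to be treated uniformly.\<close>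

lemma octagon_graph_chord_nbrs:
  assumes "x \<in> {0, 15, 30, 45}"
  shows "set (nbrs octagon_graph_edges (x + 1)) = {x, x + 2, x + 3, x + 4}"
    "set (nbrs octagon_graph_edges (x + 2)) = {x + 1, x + 3, x + 4, x + 5}"
    "set (nbrs octagon_graph_edges (x + 3)) = {x + 1, x + 2, x + 5, x + 6}"
    "set (nbrs octagon_graph_edges (x + 4)) = {x + 1, x + 2, x + 5, x + 6}"
    "set (nbrs octagon_graph_edges (x + 5)) = {x + 2, x + 3, x + 4, x + 6}"
    "set (nbrs octagon_graph_edges (x + 6)) = {x + 3, x + 4, x + 5, x + 7}"
    "set (nbrs octagon_graph_edges (x + 7)) = {x, x + 6, x + 14, x + 8}"
    "set (nbrs octagon_graph_edges (x + 8)) = {x + 7, x + 9, x + 10, x + 11}"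
    "set (nbrs octagon_graph_edges (x + 9)) = {x + 8, x + 10, x + 11, x + 12}"
    "set (nbrs octagon_graph_edges (x + 10)) = {x + 8, x + 9, x + 12, x + 13}"
    "set (nbrs octagon_graph_edges (x + 11)) = {x + 8, x + 9, x + 12, x + 13}"
    "set (nbrs octagon_graph_edges (x + 12)) = {x + 9, x + 10, x + 11, x + 13}"
    "set (nbrs octagon_graph_edges (x + 13)) = {x + 10, x + 11, x + 12, x + 14}"
  using assms by (auto simp: octagon_graph_nbrs octagon_graph_nbrs(3)[unfolded numeral_2_eq_2])

lemma octagon_graph_gadget_cuts:
  assumes "x \<in> {0, 15, 30, 45}"
  shows "u \<in> {x + 1..x + 6} \<Longrightarrow> w \<notin> {x + 1..x + 6} \<Longrightarrow>
      {u, w} \<in> uedges octagon_graph \<longleftrightarrow> (u, w) \<in> {(x + 1, x), (x + 6, x + 7)}"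
    and "u \<in> {x + 8..x + 13} \<Longrightarrow> w \<notin> {x + 8..x + 13} \<Longrightarrow>
      {u, w} \<in> uedges octagon_graph \<longleftrightarrow> (u, w) \<in> {(x + 8, x + 7), (x + 13, x + 14)}"
proof -
  assume u: "u \<in> {x + 1..x + 6}" and w: "w \<notin> {x + 1..x + 6}"
  from u consider "u = x + 1" | "u = x + 2" | "u = x + 3" | "u = x + 4" | "u = x + 5" | "u = x + 6"
    by (fastforce simp: numeral_eq_Suc le_Suc_eq)
  then show "{u, w} \<in> uedges octagon_graph \<longleftrightarrow> (u, w) \<in> {(x + 1, x), (x + 6, x + 7)}"
    by cases (use w in \<open>auto simp only: octagon_graph_adjacent_iff octagon_graph_chord_nbrs[OF assms], auto\<close>)
next
  assume u: "u \<in> {x + 8..x + 13}" and w: "w \<notin> {x + 8..x + 13}"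
  from u consider "u = x + 8" | "u = x + 9" | "u = x + 10" | "u = x + 11" | "u = x + 12" | "u = x + 13"
    by (fastforce simp: numeral_eq_Suc le_Suc_eq)
  then show "{u, w} \<in> uedges octagon_graph \<longleftrightarrow> (u, w) \<in> {(x + 8, x + 7), (x + 13, x + 14)}"
    by cases (use w in \<open>auto simp only: octagon_graph_adjacent_iff octagon_graph_chord_nbrs[OF assms], auto\<close>)
qed

section \<open>Circles in a realization of the octagon graph\<close>

locale octagon_graph_realization = circle_realization octagon_graph C \<phi> \<psi> for C \<phi> \<psi>
begin

lemma chord:
  assumes x: "x \<in> {0, 15, 30, 45}"
    and nbrs_x: "set (nbrs octagon_graph_edges x) = {l, r, x + 7, x + 1}"
    and nbrs_y: "set (nbrs octagon_graph_edges (x + 14)) = {l', r', x + 7, x + 13}"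
    and distinct: "distinct [x, l, r, x + 7, x + 1]" "distinct [x + 14, l', r', x + 7, x + 13]"
  shows "col {x, l} = col {x, r}" "col {x, x + 7} \<noteq> col {x, l}" "col {x, x + 1} = col {x, x + 7}"
    "col {x + 14, l'} = col {x + 14, r'}" "col {x + 7, x + 14} \<noteq> col {x + 14, l'}"
    "col {x + 14, x + 13} = col {x + 7, x + 14}"
    "\<And>u. u \<in> verts octagon_graph \<Longrightarrow> \<phi> u \<in> col {x, x + 7} \<Longrightarrow> u \<in> {x..x + 7}"
    "\<And>u. u \<in> verts octagon_graph \<Longrightarrow> \<phi> u \<in> col {x + 7, x + 14} \<Longrightarrow> u \<in> {x + 7..x + 14}"
proof -
  have verts: "{x, x + 7, x + 14} \<subseteq> verts octagon_graph"
    using x by (auto simp: octagon_graph_def list_graph_def)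
  have distinct': "distinct [x + 7, x, x + 6, x + 14, x + 8]"
    by simp
  note chord = chord_circles[where x = x and m = "x + 7" and y = "x + 14" and A = "{x + 1..x + 6}" and B = "{x + 8..x + 13}",
    OF verts distinct(1) distinct' distinct(2) _ _ _ _
    octagon_graph_gadget_cuts(1)[OF x] octagon_graph_gadget_cuts(2)[OF x],
    unfolded octagon_graph_adjacent_iff nbrs_x nbrs_y octagon_graph_chord_nbrs(7)[OF x], simplified]
  show "col {x, l} = col {x, r}" "col {x, x + 7} \<noteq> col {x, l}" "col {x, x + 1} = col {x, x + 7}"
    "col {x + 14, l'} = col {x + 14, r'}" "col {x + 7, x + 14} \<noteq> col {x + 14, l'}"
    "col {x + 14, x + 13} = col {x + 7, x + 14}"
    using chord by simp_all
  show "u \<in> {x..x + 7}" if "u \<in> verts octagon_graph" "\<phi> u \<in> col {x, x + 7}" for u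
    using chord(7)[of u] that by auto
  show "u \<in> {x + 7..x + 14}" if "u \<in> verts octagon_graph" "\<phi> u \<in> col {x + 7, x + 14}" for u
    using chord(8)[of u] that by auto
qed

lemma impossible: False
proof -
  define k where "k i = octagon ! i" for i
  \<comment> \<open>The neighbours of \<open>k i\<close> off the octagon are the middle
    \<open>m i\<close> of its chord and the gadget vertex \<open>g i\<close>. The set
    \<open>R i\<close> is the half chord at \<open>k i\<close>, to which the circle
    \<open>D i\<close> is confined.\<close>
  define m :: "nat \<Rightarrow> nat" where "m i = [7, 22, 37, 7, 52, 37, 22, 52] ! i" for i
  define g :: "nat \<Rightarrow> nat" where "g i = [1, 16, 31, 13, 46, 43, 28, 58] ! i" for i
  define R :: "nat \<Rightarrow> nat set" where
    "R i = [{0..7}, {15..22}, {30..37}, {7..14}, {45..52}, {37..44}, {22..29}, {52..59}] ! i" for i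
  define D where "D i = col {k i, m i}" for i
  define K where "K = col {0, 15}"
  have less_8: "i < 8 \<longleftrightarrow> i \<in> {0, Suc 0, 2, 3, 4, 5, 6, 7}" for i :: nat
    by auto
  have nbrs_octagon: "set (nbrs octagon_graph_edges 0) = {15, 59, 7, Suc 0}"
    "set (nbrs octagon_graph_edges 14) = {30, 45, 7, 13}"
    "set (nbrs octagon_graph_edges 15) = {0, 30, 22, 16}"
    "set (nbrs octagon_graph_edges 29) = {44, 59, 22, 28}"
    "set (nbrs octagon_graph_edges 30) = {15, 14, 37, 31}"
    "set (nbrs octagon_graph_edges 44) = {45, 29, 37, 43}"
    "set (nbrs octagon_graph_edges 45) = {14, 44, 52, 46}"
    "set (nbrs octagon_graph_edges 59) = {29, 0, 52, 58}"
    by (auto simp: octagon_graph_nbrs)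
  note chord_0 = chord[of 0 15 59 30 45, simplified, OF nbrs_octagon(1,2)]
  note chord_1 = chord[of 15 0 30 44 59, simplified, OF nbrs_octagon(3,4)]
  note chord_2 = chord[of 30 15 14 45 29, simplified, OF nbrs_octagon(5,6)]
  note chord_3 = chord[of 45 14 44 29 0, simplified, OF nbrs_octagon(7,8)]
  have swap: "col {u, v} = col {v, u}" for u v
    by (simp add: insert_commute)
  \<comment> \<open>At each octagon vertex the two octagon edges share a circle, so \<open>K\<close>
    is handed on from edge to edge.\<close>
  have K_edges: "col {0, 15} = K" "col {15, 30} = K" "col {30, 14} = K" "col {14, 45} = K"
    "col {45, 44} = K" "col {44, 29} = K" "col {29, 59} = K" "col {59, 0} = K"
  proof -
    show *: "col {0, 15} = K"
      by (simp add: K_def)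
    then show *: "col {15, 30} = K"
      using chord_1(1) swap[of 0 15] by simp
    then show *: "col {30, 14} = K"
      using chord_2(1) swap[of 15 30] by simp
    then show *: "col {14, 45} = K"
      using chord_0(4) swap[of 14 30] by simp
    then show *: "col {45, 44} = K"
      using chord_3(1) swap[of 14 45] by simp
    then show *: "col {44, 29} = K"
      using chord_2(4) swap[of 44 45] by simp
    then show *: "col {29, 59} = K"
      using chord_1(4) swap[of 29 44] by simp
    then show "col {59, 0} = K"
      using chord_3(4) swap[of 29 59] by simp
  qed
  have D: "D 0 = col {0, 7}" "D (Suc 0) = col {15, 22}" "D 2 = col {30, 37}" "D 3 = col {7, 14}"
    "D 4 = col {45, 52}" "D 5 = col {37, 44}" "D 6 = col {22, 29}" "D 7 = col {52, 59}"
    by (simp_all add: D_def k_def m_def octagon_def insert_commute)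
  have D_neq: "D i \<noteq> K" if "i < 8" for i
    using that chord_0(2,5) chord_1(2,5) chord_2(2,5) chord_3(2,5)
      swap[of 15 0] swap[of 30 15] swap[of 14 30] swap[of 45 14] swap[of 44 45] swap[of 29 44] swap[of 59 29]
    unfolding less_8 by (elim insertE emptyE) (simp_all only: D K_edges not_False_eq_True)
  have gadget: "col {k i, g i} = D i" if "i < 8" for i
    using that chord_0(3,6) chord_1(3,6) chord_2(3,6) chord_3(3,6)
    unfolding less_8 by (elim insertE emptyE) (simp_all add: D k_def g_def octagon_def)
  have region: "u \<in> R i" if "i < 8" "u \<in> verts octagon_graph" "\<phi> u \<in> D i" for i u
    using that chord_0(7,8)[of u] chord_1(7,8)[of u] chord_2(7,8)[of u] chord_3(7,8)[of u]
    unfolding less_8 by (elim insertE emptyE) (simp_all add: D R_def)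
  have k_verts: "k i \<in> verts octagon_graph" if "i < 8" for i
    using that unfolding less_8 by (elim insertE emptyE) (simp_all add: k_def octagon_def octagon_graph_def list_graph_def)
  have nbrs_k: "set (nbrs octagon_graph_edges (k i)) = {k (Suc i mod 8), k ((i + 7) mod 8), m i, g i}"
    if "i < 8" for i
    using that unfolding less_8
    by (elim insertE emptyE) (simp_all add: k_def m_def g_def octagon_def octagon_graph_nbrs insert_commute)
  have k_on_D: "\<phi> (k i) \<in> D i" "D i \<in> C" "\<phi> (m i) \<in> D i" if "i < 8" for i
  proof -
    have "{k i, m i} \<in> uedges octagon_graph"
      using nbrs_k[OF that] by (simp add: octagon_graph_adjacent_iff)
    then show "\<phi> (k i) \<in> D i" "D i \<in> C" "\<phi> (m i) \<in> D i"
      unfolding D_def by (auto intro: col_in vert_on_col)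
  qed
  have k_edge: "{k i, k (Suc i mod 8)} \<in> uedges octagon_graph" "col {k i, k (Suc i mod 8)} = K" if "i < 8" for i
  proof -
    show "{k i, k (Suc i mod 8)} \<in> uedges octagon_graph"
      using nbrs_k[OF that] by (simp add: octagon_graph_adjacent_iff)
    show "col {k i, k (Suc i mod 8)} = K"
      using that K_edges unfolding less_8 by (elim insertE emptyE) (simp_all add: k_def octagon_def)
  qed
  have k_on_K: "\<phi> (k i) \<in> K" if "i < 8" for i
    using vert_on_col[OF k_edge(1)[OF that], of "k i"] k_edge(2)[OF that] by simp
  have "K \<in> C"
    using col_in[OF k_edge(1)[of 0]] k_edge(2)[of 0] by simp
  have inj: "inj_on k {..<8}"
    unfolding k_def by (rule inj_on_nth) (simp_all add: octagon_def)
  have on_K: "{u \<in> verts octagon_graph. \<phi> u \<in> K} = k ` {..<8}"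
  proof
    show "k ` {..<8} \<subseteq> {u \<in> verts octagon_graph. \<phi> u \<in> K}"
      using k_verts k_on_K by auto
    have "u \<in> k ` {..<8}" if "u \<in> verts octagon_graph" "\<phi> u \<in> K" for u
    proof (rule circle_verts_confined[OF \<open>K \<in> C\<close> _ k_verts[of 0] k_on_K[of 0] _ that])
      fix v w assume v: "v \<in> k ` {..<8}" and w: "{v, w} \<in> uedges octagon_graph" "col {v, w} = K"
      then obtain i where i: "i < 8" "v = k i"
        by auto
      \<comment> \<open>Both edges into the chord lie on \<open>D i\<close>, so \<open>K\<close> can
        only continue along the octagon.\<close>
      then have "w \<noteq> m i" "w \<noteq> g i"
        using D_neq[OF i(1)] gadget[OF i(1)] w(2) by (auto simp: D_def)
      then have "w = k (Suc i mod 8) \<or> w = k ((i + 7) mod 8)"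
        using w(1) nbrs_k[OF i(1)] i(2) by (simp add: octagon_graph_adjacent_iff)
      then show "w \<in> k ` {..<8}"
        by auto
    qed auto
    then show "{u \<in> verts octagon_graph. \<phi> u \<in> K} \<subseteq> k ` {..<8}"
      by blast
  qed
  have k_region: "j = i" if "i < 8" "j < 8" "k j \<in> R i" for i j
    using that unfolding less_8
    by (elim insertE emptyE) (simp_all add: k_def R_def octagon_def)
  show False
  proof (rule no_octagon_with_chords[OF \<open>K \<in> C\<close> inj on_K])
    show "D i \<in> C" "D i \<noteq> K" "\<phi> (k i) \<in> D i" if "i < 8" for i
      using that k_on_D D_neq by auto
    show "j = i" if "i < 8" "j < 8" "\<phi> (k j) \<in> D i" for i j
      using k_region[OF that(1,2)] region[OF that(1) k_verts[OF that(2)] that(3)] .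
    show "j = Suc i mod 8 \<or> i = Suc j mod 8"
      if ij: "i < 8" "j < 8" and e: "{k i, k j} \<in> uedges octagon_graph" for i j
    proof -
      have "k j \<noteq> m i" "k j \<noteq> g i"
        using ij unfolding less_8 by (elim insertE emptyE; simp add: k_def m_def g_def octagon_def)+
      then have "k j = k (Suc i mod 8) \<or> k j = k ((i + 7) mod 8)"
        using e nbrs_k[OF ij(1)] by (simp add: octagon_graph_adjacent_iff)
      then have "j = Suc i mod 8 \<or> j = (i + 7) mod 8"
        using inj_onD[OF inj, of j "Suc i mod 8"] inj_onD[OF inj, of j "(i + 7) mod 8"] ij by auto
      moreover have "Suc ((i + 7) mod 8) mod 8 = i"
        using ij(1) by (simp add: mod_Suc_eq)
      ultimately show ?thesis
        by auto
    qed
    show "D i \<inter> D j \<noteq> {}" if "(i, j) \<in> {(0, 3), (1, 6), (2, 5), (4, 7)}" for i j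
    proof -
      have "i < 8" "j < 8" "m i = m j"
        using that by (auto simp: m_def)
      then show ?thesis
        using k_on_D(3)[of i] k_on_D(3)[of j] by auto
    qed
    show "D i \<inter> D j = {}" if ij: "i < j" "j < 8" and "(i, j) \<notin> {(0, 3), (1, 6), (2, 5), (4, 7)}" for i j
    proof (rule ccontr)
      assume "D i \<inter> D j \<noteq> {}"
      \<comment> \<open>Such a point would be a vertex of two half chords, but half chords of
        different chords are disjoint.\<close>
      then obtain q where q: "q \<in> D i" "q \<in> D j"
        by blast
      have "i < 8" "j < 8"
        using ij by auto
      have "D i \<noteq> D j"
        using k_region[OF \<open>j < 8\<close> \<open>i < 8\<close>] region[OF \<open>j < 8\<close> k_verts[OF \<open>i < 8\<close>]] k_on_D(1)[OF \<open>i < 8\<close>] ij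
        by auto
      then have "q \<in> meeting_points C"
        using q k_on_D(2)[OF \<open>i < 8\<close>] k_on_D(2)[OF \<open>j < 8\<close>] by (auto simp: meeting_points_def)
      then obtain u where u: "u \<in> verts octagon_graph" "q = \<phi> u"
        using bij_verts by (auto simp: bij_betw_def)
      then have "u \<in> R i" "u \<in> R j"
        using region \<open>i < 8\<close> \<open>j < 8\<close> q by auto
      moreover have "R i \<inter> R j = {}"
        using \<open>i < 8\<close> \<open>j < 8\<close> that unfolding less_8
        by (elim insertE emptyE) (simp_all add: R_def)
      ultimately show False
        by blast
    qed
  qed
qed

end

lemma octagon_graph_not_realizable: "\<not> realizes C octagon_graph"
proof
  assume "realizes C octagon_graph"
  then obtain \<phi> \<psi> where real: "circle_system C"
    "bij_betw \<phi> (verts octagon_graph) (meeting_points C)"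
    "bij_betw \<psi> (uedges octagon_graph) (circle_segments C)"
    "\<forall>e\<in>uedges octagon_graph. \<psi> e \<inter> meeting_points C = \<phi> ` e"
    unfolding realizes_def by blast
  interpret octagon_graph_realization C \<phi> \<psi>
    by (intro octagon_graph_realization.intro circle_realization.intro graph_octagon_graph real(1-3) bspec[OF real(4)])
  show False
    by (rule impossible)
qed

theorem theorem5:
  shows "\<exists>G :: (nat, nat \<times> nat) pre_digraph.
    graph G \<and> biconnected G \<and> regular 4 G \<and> planar G \<and> \<not> (\<exists>C. realizes C G)"
  using graph_octagon_graph biconnected_octagon_graph regular_octagon_graph planar_octagon_graph
    octagon_graph_not_realizable by blast

end
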